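(* Let $n\ge 1$, $d\ge 2$. For every M-convex set $J\subseteq \Delta_n^d$, there exists $q>0$ (depending on $J$) such that $$\mathrm{N}\,\mathrm{Gr}_J^{\mathrm w}(\mathbb T_q)\subseteq \mathbb P\mathrm L_J\subseteq \mathrm{N}\,\mathrm{Gr}_J^{\mathrm w}(\mathbb T_2).$$
   Context: **Notation.** $\mathbb N=\{0,1,2,\dots\}$; $e_1,\dots,e_n$ are the standard basis vectors of $\mathbb N^n$; $\Delta_n^d=\{\alpha\in\mathbb N^n:\alpha_1+\cdots+\alpha_n=d\}$; $\alpha!=\alpha_1!\cdots\alpha_n!$; $x^\alpha=x_1^{\alpha_1}\cdots x_n^{\alpha_n}$; inequalities between vectors are coordinatewise. The support of a polynomial $f=\sum_\alpha c_\alpha x^\alpha/\alpha!$, or of a function $\rho$ on $\Delta_n^d$, is the set of $\alpha$ with $c_\alpha\ne0$, resp. $\rho(\alpha)\neq 0$. **M-convex sets.** A nonempty $J\subseteq\Delta_n^d$ is M-convex if for all $\alpha,\beta\in J$ and every $i$ with $\alpha_i<\beta_i$ there is $j$ with $\alpha_j>\beta_j$ such that $\alpha+e_i-e_j\in J$ and $\beta-e_i+e_j\in J$. Let $\delta_J^-$ and $\delta_J^+$ be the coordinatewise minimum and maximum of $J$. **Lorentzian polynomials.** A homogeneous polynomial $f$ of degree $d$ in $x_1,\dots,x_n$ with nonnegative real coefficients is strictly Lorentzian if for every $\alpha\in\Delta_n^{d-2}$ the Hessian of the quadratic form $\partial^\alpha f$ (which has nonnegative entries) has exactly one positive and $n-1$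 negative eigenvalues. A Lorentzian polynomial is a limit of strictly Lorentzian polynomials. $\mathrm L_J$ is the set of Lorentzian polynomials with support $J$, and $\mathbb P\mathrm L_J$ is its quotient by multiplication by positive reals. **Weak representations.** For $q>0$, nonnegative reals $a,b,c$ satisfy the $\mathbb T_q$-relation if $a^{1/q},b^{1/q},c^{1/q}$ are the side lengths of a (possibly degenerate) Euclidean triangle, i.e. each is at most the sum of the other two. A weak $\mathbb T_q$-representation of $J$ is a function $\rho:\Delta_n^d\to\mathbb R_{\ge0}$ with support $J$ such that for every $\alpha\in\Delta_n^{d-2}$ and $1\le i\le j\le k\le\ell\le n$ with $\delta_J^-\le\alpha$ and $\alpha+e_i+e_j+e_k+e_\ell\le\delta_J^+$, the three numbers $\rho(\alpha+e_j+e_k)\rho(\alpha+e_i+e_\ell)$, $\rho(\alpha+e_i+e_k)\rho(\alpha+e_j+e_\ell)$, $\rho(\alpha+e_i+e_j)\rho(\alpha+e_k+e_\ell)$ satisfy the $\mathbb T_q$-relation. $\rho$ is identified with the polynomial $f_\rho=\sum_{\alpha\in J}\rho(\alpha)x^\alpha/\alpha!$. $\mathrm{Gr}_J^{\mathrm w}(\mathbb T_q)$ is the set of weak $\mathbb T_q$-representations of $J$ (as polynomials) modulo multiplication by positive reals. **Normalization operator.** $\mathrm N$ is the linear operator on homogeneous polynomials with $\mathrm N(x^\alpha)=x^\alpha/\alpha!$; it induces a map on classes modulo positive scaling. Thus $\mathrm N f_\rho=\sum_{\alpha\in J}\frac{\rho(\alpha)}{\alpha!}\frac{x^\alpha}{\alpha!}$.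 *)

theory Defs
  imports
    "HOL-Library.Poly_Mapping"
    "Jordan_Normal_Form.Char_Poly"
begin

text \<open>
  Exponent vectors are finitely supported functions on \<open>nat\<close>, and polynomials are finitely
  supported coefficient functions on exponent vectors.  The variables \<open>x\<^sub>1, \<dots>, x\<^sub>n\<close> are indexed
  by \<open>0, \<dots>, n - 1\<close>.  Caution: the library order \<open>\<le>\<close> on \<open>nat \<Rightarrow>\<^sub>0 nat\<close> is lexicographic, so
  coordinatewise inequalities are always written out.
\<close>

type_synonym expo = "nat \<Rightarrow>\<^sub>0 nat"
type_synonym rpoly = "expo \<Rightarrow>\<^sub>0 real"

abbreviation unit_expo :: "nat \<Rightarrow> expo" where
  "unit_expo i \<equiv> Poly_Mapping.single i 1"

abbreviation expo_at :: "expo \<Rightarrow> nat \<Rightarrow> nat" where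
  "expo_at \<equiv> Poly_Mapping.lookup"

abbreviation coef :: "rpoly \<Rightarrow> expo \<Rightarrow> real" where
  "coef \<equiv> Poly_Mapping.lookup"

abbreviation supp :: "rpoly \<Rightarrow> expo set" where
  "supp \<equiv> Poly_Mapping.keys"

definition Delta :: "nat \<Rightarrow> nat \<Rightarrow> expo set" where
  "Delta n d = {\<alpha>. Poly_Mapping.keys \<alpha> \<subseteq> {..<n} \<and> (\<Sum>i<n. expo_at \<alpha> i) = d}"

definition expo_fact :: "expo \<Rightarrow> real" where
  "expo_fact \<alpha> = (\<Prod>i\<in>Poly_Mapping.keys \<alpha>. fact (expo_at \<alpha> i))"


section \<open>M-convex sets\<close>

text \<open>
  Subtraction of exponent vectors is truncated, but here the subtracted unit vector always lies
  below the vector it is subtracted from.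
\<close>

definition M_convex :: "nat \<Rightarrow> nat \<Rightarrow> expo set \<Rightarrow> bool" where
  "M_convex n d J \<longleftrightarrow>
     J \<noteq> {} \<and> J \<subseteq> Delta n d \<and>
     (\<forall>\<alpha>\<in>J. \<forall>\<beta>\<in>J. \<forall>i<n. expo_at \<alpha> i < expo_at \<beta> i \<longrightarrow>
        (\<exists>j<n. expo_at \<alpha> j > expo_at \<beta> j \<and>
               \<alpha> + unit_expo i - unit_expo j \<in> J \<and>
               \<beta> - unit_expo i + unit_expo j \<in> J))"

definition delta_minus :: "expo set \<Rightarrow> nat \<Rightarrow> nat" where
  "delta_minus J i = Min ((\<lambda>\<alpha>. expo_at \<alpha> i) ` J)"

definition delta_plus :: "expo set \<Rightarrow> nat \<Rightarrow> nat" where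
  "delta_plus J i = Max ((\<lambda>\<alpha>. expo_at \<alpha> i) ` J)"


section \<open>Lorentzian polynomials\<close>

definition homogeneous_poly :: "nat \<Rightarrow> nat \<Rightarrow> rpoly \<Rightarrow> bool" where
  "homogeneous_poly n d f \<longleftrightarrow> supp f \<subseteq> Delta n d"

text \<open>Terms with \<open>expo_at \<alpha> i = 0\<close> have coefficient \<open>0\<close>, so truncation is harmless.\<close>

definition mpderiv :: "nat \<Rightarrow> rpoly \<Rightarrow> rpoly" where
  "mpderiv i f =
     (\<Sum>\<alpha>\<in>supp f. Poly_Mapping.single (\<alpha> - unit_expo i) (real (expo_at \<alpha> i) * coef f \<alpha>))"

definition multi_mpderiv :: "nat \<Rightarrow> expo \<Rightarrow> rpoly \<Rightarrow> rpoly" where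
  "multi_mpderiv n \<alpha> f = fold (\<lambda>i. mpderiv i ^^ expo_at \<alpha> i) [0..<n] f"

text \<open>
  The second partial derivatives of a quadratic form are constant polynomials; the matrix entry
  is that constant, read off as the coefficient of the zero exponent.
\<close>

definition quadratic_hessian :: "nat \<Rightarrow> rpoly \<Rightarrow> real mat" where
  "quadratic_hessian n g = mat n n (\<lambda>(i, j). coef (mpderiv i (mpderiv j g)) 0)"

text \<open>Real eigenvalues of a square matrix, counted with algebraic multiplicity.\<close>

definition num_pos_eigenvalues :: "real mat \<Rightarrow> nat" where
  "num_pos_eigenvalues A = size (filter_mset (\<lambda>x. x > 0) (proots (char_poly A)))"

definition num_neg_eigenvalues :: "real mat \<Rightarrow> nat" where
  "num_neg_eigenvalues A = size (filter_mset (\<lambda>x. x < 0) (proots (char_poly A)))"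

definition strictly_Lorentzian :: "nat \<Rightarrow> nat \<Rightarrow> rpoly \<Rightarrow> bool" where
  "strictly_Lorentzian n d f \<longleftrightarrow>
     homogeneous_poly n d f \<and> (\<forall>\<alpha>. coef f \<alpha> \<ge> 0) \<and>
     (\<forall>\<alpha>\<in>Delta n (d - 2).
        num_pos_eigenvalues (quadratic_hessian n (multi_mpderiv n \<alpha> f)) = 1 \<and>
        num_neg_eigenvalues (quadratic_hessian n (multi_mpderiv n \<alpha> f)) = n - 1)"

text \<open>
  Limits are taken in the finite-dimensional space of homogeneous polynomials of degree \<open>d\<close> in
  \<open>n\<close> variables, where convergence is coefficientwise.
\<close>

definition Lorentzian :: "nat \<Rightarrow> nat \<Rightarrow> rpoly \<Rightarrow> bool" where
  "Lorentzian n d f \<longleftrightarrow>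
     homogeneous_poly n d f \<and>
     (\<exists>F. (\<forall>m::nat. strictly_Lorentzian n d (F m)) \<and>
          (\<forall>\<alpha>. (\<lambda>m. coef (F m) \<alpha>) \<longlonglongrightarrow> coef f \<alpha>))"

definition Lorentzian_with_support :: "nat \<Rightarrow> nat \<Rightarrow> expo set \<Rightarrow> rpoly set" where
  "Lorentzian_with_support n d J = {f. Lorentzian n d f \<and> supp f = J}"

definition scale_poly :: "real \<Rightarrow> rpoly \<Rightarrow> rpoly" where
  "scale_poly c f = Poly_Mapping.map (\<lambda>x. c * x) f"

definition pos_scaling :: "(rpoly \<times> rpoly) set" where
  "pos_scaling = {(f, g). \<exists>c>0. g = scale_poly c f}"

definition PL :: "nat \<Rightarrow> nat \<Rightarrow> expo set \<Rightarrow> rpoly set set" where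
  "PL n d J = Lorentzian_with_support n d J // pos_scaling"


section \<open>Weak representations over the triangular hyperfields\<close>

definition T_relation :: "real \<Rightarrow> real \<Rightarrow> real \<Rightarrow> real \<Rightarrow> bool" where
  "T_relation q a b c \<longleftrightarrow>
     a powr (1 / q) \<le> b powr (1 / q) + c powr (1 / q) \<and>
     b powr (1 / q) \<le> a powr (1 / q) + c powr (1 / q) \<and>
     c powr (1 / q) \<le> a powr (1 / q) + b powr (1 / q)"

text \<open>
  Only the values of \<open>\<rho>\<close> on \<open>Delta n d\<close> matter: \<open>\<rho>\<close> stands for its restriction to that set.
\<close>

definition weak_T_representation ::
    "nat \<Rightarrow> nat \<Rightarrow> expo set \<Rightarrow> real \<Rightarrow> (expo \<Rightarrow> real) \<Rightarrow> bool" where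
  "weak_T_representation n d J q \<rho> \<longleftrightarrow>
     (\<forall>\<alpha>\<in>Delta n d. \<rho> \<alpha> \<ge> 0) \<and>
     {\<alpha> \<in> Delta n d. \<rho> \<alpha> \<noteq> 0} = J \<and>
     (\<forall>\<alpha>\<in>Delta n (d - 2). \<forall>i j k l.
        i \<le> j \<and> j \<le> k \<and> k \<le> l \<and> l < n \<and>
        (\<forall>m<n. delta_minus J m \<le> expo_at \<alpha> m) \<and>
        (\<forall>m<n. expo_at (\<alpha> + unit_expo i + unit_expo j + unit_expo k + unit_expo l) m
                 \<le> delta_plus J m) \<longrightarrow>
        T_relation q
          (\<rho> (\<alpha> + unit_expo j + unit_expo k) * \<rho> (\<alpha> + unit_expo i + unit_expo l))
          (\<rho> (\<alpha> + unit_expo i + unit_expo k) * \<rho> (\<alpha> + unit_expo j + unit_expo l))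
          (\<rho> (\<alpha> + unit_expo i + unit_expo j) * \<rho> (\<alpha> + unit_expo k + unit_expo l)))"

definition repr_poly :: "expo set \<Rightarrow> (expo \<Rightarrow> real) \<Rightarrow> rpoly" where
  "repr_poly J \<rho> = (\<Sum>\<alpha>\<in>J. Poly_Mapping.single \<alpha> (\<rho> \<alpha> / expo_fact \<alpha>))"

definition Gr_weak :: "nat \<Rightarrow> nat \<Rightarrow> expo set \<Rightarrow> real \<Rightarrow> rpoly set set" where
  "Gr_weak n d J q = {repr_poly J \<rho> | \<rho>. weak_T_representation n d J q \<rho>} // pos_scaling"


section \<open>The normalization operator\<close>

definition Nop :: "rpoly \<Rightarrow> rpoly" where
  "Nop f = (\<Sum>\<alpha>\<in>supp f. Poly_Mapping.single \<alpha> (coef f \<alpha> / expo_fact \<alpha>))"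

text \<open>
  The induced map on classes is the direct image; that the image of a class is again a class is
  \<open>Nop_image_class\<close> below.
\<close>

definition Nop_class :: "rpoly set \<Rightarrow> rpoly set" where
  "Nop_class C = Nop ` C"


section \<open>Basic properties\<close>

lemma sum_single_lookup:
  fixes g :: "expo \<Rightarrow> real"
  assumes "finite A"
  shows "coef (\<Sum>\<alpha>\<in>A. Poly_Mapping.single \<alpha> (g \<alpha>)) \<beta> = (if \<beta> \<in> A then g \<beta> else 0)"
  using assms by (simp add: lookup_sum lookup_single when_def)

lemma coef_Nop: "coef (Nop f) \<alpha> = coef f \<alpha> / expo_fact \<alpha>"
  unfolding Nop_def by (simp add: sum_single_lookup in_keys_iff)

lemma Nop_add: "Nop (f + g) = Nop f + Nop g"
  by (rule poly_mapping_eqI) (simp add: coef_Nop lookup_add add_divide_distrib)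

lemma coef_scale_poly: "coef (scale_poly c f) \<alpha> = c * coef f \<alpha>"
  unfolding scale_poly_def by (simp add: map.rep_eq when_def)

lemma Nop_scale_poly: "Nop (scale_poly c f) = scale_poly c (Nop f)"
  by (rule poly_mapping_eqI) (simp add: coef_Nop coef_scale_poly)

lemma Nop_monomial:
  "Nop (Poly_Mapping.single \<alpha> 1) = Poly_Mapping.single \<alpha> (1 / expo_fact \<alpha>)"
  by (rule poly_mapping_eqI) (simp add: coef_Nop lookup_single when_def)

lemma equiv_pos_scaling: "equiv UNIV pos_scaling"
proof (rule equivI)
  have one: "scale_poly 1 f = f" for f
    by (rule poly_mapping_eqI) (simp add: coef_scale_poly)
  have mult: "scale_poly a (scale_poly b f) = scale_poly (a * b) f" for a b f
    by (rule poly_mapping_eqI) (simp add: coef_scale_poly)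
  show "pos_scaling \<subseteq> UNIV \<times> UNIV" by simp
  show "refl pos_scaling"
    unfolding pos_scaling_def refl_on_def using one by (auto intro!: exI[of _ 1])
  show "sym pos_scaling"
  proof (rule symI)
    fix f g assume "(f, g) \<in> pos_scaling"
    then obtain c where "c > 0" "g = scale_poly c f" by (auto simp: pos_scaling_def)
    then have "inverse c > 0" "f = scale_poly (inverse c) g" by (simp_all add: mult one)
    then show "(g, f) \<in> pos_scaling" unfolding pos_scaling_def by blast
  qed
  show "trans pos_scaling"
  proof (rule transI)
    fix f g h assume "(f, g) \<in> pos_scaling" "(g, h) \<in> pos_scaling"
    then obtain a b where "a > 0" "g = scale_poly a f" "b > 0" "h = scale_poly b g"
      by (auto simp: pos_scaling_def)
    then have "b * a > 0" "h = scale_poly (b * a) f" by (simp_all add: mult)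
    then show "(f, h) \<in> pos_scaling" unfolding pos_scaling_def by blast
  qed
qed

lemma Nop_image_class: "Nop_class (pos_scaling `` {f}) = pos_scaling `` {Nop f}"
  unfolding Nop_class_def pos_scaling_def by (force simp: Nop_scale_poly)

lemma coef_mpderiv:
  "coef (mpderiv i f) \<alpha> = real (expo_at \<alpha> i + 1) * coef f (\<alpha> + unit_expo i)"
proof -
  have shift: "\<beta> - unit_expo i = \<alpha> \<longleftrightarrow> \<beta> = \<alpha> + unit_expo i" if "expo_at \<beta> i \<noteq> 0" for \<beta>
  proof
    assume "\<beta> - unit_expo i = \<alpha>"
    then show "\<beta> = \<alpha> + unit_expo i"
      using that by (auto intro!: poly_mapping_eqI simp: lookup_add lookup_minus lookup_single when_def)
  qed simp
  have "coef (mpderiv i f) \<alpha> =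
      (\<Sum>\<beta>\<in>supp f. if \<beta> = \<alpha> + unit_expo i then real (expo_at \<beta> i) * coef f \<beta> else 0)"
    unfolding mpderiv_def lookup_sum lookup_single when_def
  proof (rule sum.cong[OF refl])
    fix \<beta>
    show "(if \<beta> - unit_expo i = \<alpha> then real (expo_at \<beta> i) * coef f \<beta> else 0) =
        (if \<beta> = \<alpha> + unit_expo i then real (expo_at \<beta> i) * coef f \<beta> else 0)"
      using shift[of \<beta>] by (cases "expo_at \<beta> i = 0") auto
  qed
  also have "\<dots> = real (expo_at \<alpha> i + 1) * coef f (\<alpha> + unit_expo i)"
    by (simp add: lookup_add in_keys_iff)
  finally show ?thesis .
qed

end

theory Submission
  imports Defs "HOL-Analysis.Function_Topology" "HOL-Analysis.Convex"
begin

text \<open>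
  Let \<open>f\<close> be homogeneous of degree \<open>d\<close> with coefficients \<open>f\<^sub>\<beta>\<close>, and let \<open>c(\<beta>) = \<beta>! f\<^sub>\<beta>\<close> be its
  normalized coefficients.  For \<open>\<alpha> \<in> Delta n (d - 2)\<close> the Hessian of \<open>\<partial>\<^sup>\<alpha> f\<close> is the matrix with
  entries \<open>c(\<alpha> + e\<^sub>i + e\<^sub>j)\<close>.  A symmetric form \<open>Q\<close> has at most one positive eigenvalue if and only
  if it satisfies the reverse Cauchy--Schwarz inequality: \<open>Q(x,x) > 0\<close> implies
  \<open>Q(x,x) Q(y,y) \<le> Q(x,y)\<^sup>2\<close>.  This condition (\<open>reverse_CS\<close>) is stable under limits and under
  congruence, and both inclusions are obtained from it; the spectral theorem for real symmetric
  matrices translates it into counts of eigenvalues.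

  \<^bold>\<open>Lorentzian polynomials are weak representations.\<close>  The Hessians \<open>H\<close> of a limit of strictly
  Lorentzian polynomials satisfy the reverse Cauchy--Schwarz inequality.  Applied to
  \<open>x = s e\<^sub>i + t e\<^sub>j\<close> and \<open>y = u e\<^sub>k + v e\<^sub>l\<close>, with the best choice of \<open>s, t, u, v > 0\<close>, it yields
  \<open>\<surd>(H\<^sub>i\<^sub>j H\<^sub>k\<^sub>l) \<le> \<surd>(H\<^sub>i\<^sub>k H\<^sub>j\<^sub>l) + \<surd>(H\<^sub>i\<^sub>l H\<^sub>j\<^sub>k)\<close>, and if \<open>i = j\<close> or \<open>k = l\<close> the product on the left may
  be multiplied by \<open>2\<close> for each of these coincidences (\<open>reverse_CS_four_entries\<close>).  This extra
  factor is what the passage from \<open>H\<close> to \<open>\<rho>(\<beta>) = \<beta>! c(\<beta>)\<close> costs.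

  \<^bold>\<open>Weak representations give Hessians with at most one positive eigenvalue.\<close>  For \<open>q \<le> 1\<close> the
  \<open>\<^bold>T\<^sub>q\<close>-relation of \<open>a, b, c\<close> implies \<open>a \<le> max b c + q min b c\<close>.  Fix \<open>r\<close>, and divide the entries
  \<open>R\<^sub>i\<^sub>j = \<rho>(\<alpha> + e\<^sub>i + e\<^sub>j)\<close> by \<open>R\<^sub>r\<^sub>i R\<^sub>r\<^sub>j\<close> where
  this is positive.  The relations then say that the resulting matrix is
  nearly an ultrametric, and its off-diagonal part defines a negative semidefinite form on the
  vectors with coordinate sum \<open>0\<close>, with a margin that compensates for the diagonal entries up to
  a relative error of order \<open>2\<^sup>n q\<close> (\<open>near_ultrametric_form_neg\<close>).  In the Hessian of the
  normalized polynomial the diagonal entries of \<open>R\<close> are lowered by the factors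
  \<open>(\<alpha>\<^sub>i + 1) / (\<alpha>\<^sub>i + 2) \<le> 1 - 1 / d\<close>.  For
  \<open>q = 1 / (d 2\<^sup>n\<^sup>+\<^sup>4)\<close> this gap absorbs the error (\<open>reverse_CS_if_four_point\<close>).

  \<^bold>\<open>Such polynomials are Lorentzian if their support is M-convex.\<close>  The reverse Cauchy--Schwarz
  inequality passes from the Hessians of the \<open>\<partial>\<^sup>\<alpha> f\<close> to those of the iterated derivatives of \<open>f\<close>
  in arbitrary directions with positive coordinates (\<open>reverse_CS_local_to_global\<close>,
  \<open>reverse_CS_mixed_derivatives\<close>); M-convexity provides the irreducibility that this step needs.
  Hence \<open>f(V x)\<close>, where \<open>V\<close> is the identity plus \<open>t\<close> times the all-ones matrix, has positive
  coefficients and Hessians with exactly one positive eigenvalue.  Subtracting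
  \<open>s \<Sum>\<^sub>\<beta> x\<^sup>\<beta>\<close> with a small \<open>s > 0\<close> makes the other eigenvalues negative: the normalized coefficients
  \<open>\<beta>!\<close> of \<open>\<Sum>\<^sub>\<beta> x\<^sup>\<beta>\<close> are moments of exponential distributions, so all its Hessians are positive
  definite.  For \<open>s, t \<rightarrow> 0\<close> one obtains \<open>f\<close> as a limit of strictly Lorentzian polynomials
  (\<open>Lorentzian_if_reverse_CS\<close>).
\<close>

section \<open>Symmetric bilinear forms and their eigenvalues\<close>

text \<open>
  Vectors are functions on \<open>nat\<close> and matrices are functions of two indices; only the indices below
  \<open>n\<close> matter.  This is the standard inner product of \<open>\<real>\<^sup>n\<close>.
\<close>

definition ip :: "nat \<Rightarrow> (nat \<Rightarrow> real) \<Rightarrow> (nat \<Rightarrow> real) \<Rightarrow> real" where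
  "ip n x y = (\<Sum>i<n. x i * y i)"

text \<open>
  The bilinear form with matrix \<open>A\<close>.
\<close>

definition bform :: "nat \<Rightarrow> (nat \<Rightarrow> nat \<Rightarrow> real) \<Rightarrow> (nat \<Rightarrow> real) \<Rightarrow> (nat \<Rightarrow> real) \<Rightarrow> real" where
  "bform n A x y = (\<Sum>i<n. \<Sum>j<n. A i j * x i * y j)"

text \<open>
  Symmetry of the upper left \<open>n \<times> n\<close> block, the only part of \<open>A\<close> that \<open>bform n A\<close> depends on.
\<close>

definition symmetric_on :: "nat \<Rightarrow> (nat \<Rightarrow> nat \<Rightarrow> real) \<Rightarrow> bool" where
  "symmetric_on n A \<longleftrightarrow> (\<forall>i<n. \<forall>j<n. A i j = A j i)"

lemma ip_commute: "ip n x y = ip n y x"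
  by (simp add: ip_def mult.commute)

lemma ip_add_left: "ip n (\<lambda>i. x i + y i) z = ip n x z + ip n y z"
  by (simp add: ip_def algebra_simps sum.distrib)

lemma ip_diff_left: "ip n (\<lambda>i. x i - y i) z = ip n x z - ip n y z"
  by (simp add: ip_def algebra_simps sum_subtractf)

lemma ip_scale_left: "ip n (\<lambda>i. c * x i) z = c * ip n x z"
  by (simp add: ip_def algebra_simps sum_distrib_left)

lemma ip_add_right: "ip n z (\<lambda>i. x i + y i) = ip n z x + ip n z y"
  by (simp add: ip_def algebra_simps sum.distrib)

lemma ip_scale_right: "ip n z (\<lambda>i. c * x i) = c * ip n z x"
  by (simp add: ip_def algebra_simps sum_distrib_left)

lemma ip_sum_left: "ip n (\<lambda>i. \<Sum>a\<in>S. f a i) z = (\<Sum>a\<in>S. ip n (f a) z)"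
  unfolding ip_def by (subst sum.swap) (simp add: sum_distrib_right)

lemma ip_nonneg: "ip n x x \<ge> 0"
  by (simp add: ip_def sum_nonneg)

lemma ip_eq_0D: "ip n x x = 0 \<Longrightarrow> i < n \<Longrightarrow> x i = 0"
  unfolding ip_def by (subst (asm) sum_nonneg_eq_0_iff) auto

lemma bform_eq_ip: "bform n A x y = ip n x (\<lambda>i. \<Sum>j<n. A i j * y j)"
  by (simp add: bform_def ip_def sum_distrib_left mult_ac)

lemma bform_commute:
  assumes "symmetric_on n A"
  shows "bform n A x y = bform n A y x"
proof -
  have "bform n A x y = (\<Sum>j<n. \<Sum>i<n. A i j * x i * y j)"
    unfolding bform_def by (rule sum.swap)
  also have "\<dots> = bform n A y x"
    unfolding bform_def using assms by (intro sum.cong refl) (auto simp: symmetric_on_def)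
  finally show ?thesis .
qed

lemma bform_add_right: "bform n A x (\<lambda>i. y i + z i) = bform n A x y + bform n A x z"
  by (simp add: bform_def algebra_simps sum.distrib)

lemma bform_add_left: "bform n A (\<lambda>i. y i + z i) x = bform n A y x + bform n A z x"
  by (simp add: bform_def algebra_simps sum.distrib)

lemma bform_scale_right: "bform n A x (\<lambda>i. c * y i) = c * bform n A x y"
  by (simp add: bform_def algebra_simps sum_distrib_left)

lemma bform_scale_left: "bform n A (\<lambda>i. c * y i) x = c * bform n A y x"
  by (simp add: bform_def algebra_simps sum_distrib_left)

lemmas bform_simps = bform_add_right bform_add_left bform_scale_right bform_scale_left

lemma orthonormal_extend:
  assumes "k < n" and on: "\<And>a b. a < k \<Longrightarrow> b < k \<Longrightarrow> ip n (u a) (u b) = (if a = b then 1 else 0)"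
  shows "\<exists>x. ip n x x > 0 \<and> (\<forall>a<k. ip n x (u a) = 0)"
proof -
  \<comment> \<open>The projections of the unit vectors to the span of the \<open>u a\<close> have total squared length \<open>k < n\<close>.\<close>
  have "(\<Sum>i<n. \<Sum>a<k. (u a i)\<^sup>2) = (\<Sum>a<k. ip n (u a) (u a))"
    by (subst sum.swap) (simp add: ip_def power2_eq_square)
  also have "\<dots> = real k" using on by simp
  also have "\<dots> < (\<Sum>i<n. 1)" using assms(1) by simp
  finally have "\<exists>i\<in>{..<n}. (\<Sum>a<k. (u a i)\<^sup>2) < 1"
    by (meson not_le sum_mono)
  then obtain i where i: "i < n" "(\<Sum>a<k. (u a i)\<^sup>2) < 1" by auto
  define e where "e = (\<lambda>j. if j = i then 1 else 0 :: real)"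
  define x where "x = (\<lambda>j. e j - (\<Sum>a<k. u a i * u a j))"
  have e: "ip n e y = y i" for y
    using i by (simp add: ip_def e_def if_distrib[of "\<lambda>c. c * _"] cong: if_cong)
  have orth: "ip n x (u b) = 0" if "b < k" for b
  proof -
    have "ip n x (u b) = u b i - (\<Sum>a<k. u a i * ip n (u a) (u b))"
      unfolding x_def ip_diff_left ip_sum_left ip_scale_left e ..
    also have "(\<Sum>a<k. u a i * ip n (u a) (u b)) = (\<Sum>a<k. if a = b then u a i else 0)"
      using on that by (intro sum.cong) auto
    finally show ?thesis using that by simp
  qed
  have "ip n x x = ip n e x - (\<Sum>a<k. u a i * ip n (u a) x)"
    by (subst x_def) (simp only: ip_diff_left ip_sum_left ip_scale_left)
  also have "\<dots> = x i" using orth by (simp add: ip_commute[of n "u _" x] e)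
  also have "\<dots> > 0" using i by (simp add: x_def e_def power2_eq_square)
  finally show ?thesis using orth by blast
qed

lemma continuous_on_bform_ip:
  fixes A :: "nat \<Rightarrow> nat \<Rightarrow> real"
  shows "continuous_on S (\<lambda>x. bform n A x x)" "continuous_on S (\<lambda>x. ip n x x)"
    "continuous_on S (\<lambda>x. ip n x y)"
  unfolding bform_def ip_def
  by (intro continuous_intros continuous_on_subset[OF continuous_on_product_coordinates]; simp)+

text \<open>
  The quadratic form attains its maximum over the unit vectors orthogonal to \<open>u 0, \<dots>, u (k - 1)\<close>;
  by homogeneity the bound extends to all orthogonal vectors.
\<close>

lemma constrained_maximum:
  assumes "k < n" and on: "\<And>a b. a < k \<Longrightarrow> b < k \<Longrightarrow> ip n (u a) (u b) = (if a = b then 1 else 0)"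
  shows "\<exists>z. ip n z z = 1 \<and> (\<forall>a<k. ip n z (u a) = 0) \<and>
     (\<forall>w. (\<forall>a<k. ip n w (u a) = 0) \<longrightarrow> bform n A w w \<le> bform n A z z * ip n w w)"
proof -
  \<comment> \<open>Setting the irrelevant coordinates to \<open>0\<close> makes the unit sphere compact in the product topology.\<close>
  define K where "K = (\<Pi>\<^sub>E i\<in>UNIV. if i < n then {-1..1::real} else {0})"
  define S where "S = {x \<in> K. ip n x x = 1 \<and> (\<forall>a<k. ip n x (u a) = 0)}"
  have "compactin (product_topology (\<lambda>i. euclidean) UNIV) K"
    unfolding K_def compactin_PiE by (auto simp: compactin_euclidean_iff)
  then have K: "compact K" by (simp add: euclidean_product_topology compactin_euclidean_iff)
  have "S = K \<inter> ((\<lambda>x. ip n x x) -` {1} \<inter> (\<Inter>a\<in>{..<k}. (\<lambda>x. ip n x (u a)) -` {0}))"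
    by (auto simp: S_def)
  moreover have "closed ((\<lambda>x. ip n x x) -` {1} \<inter> (\<Inter>a\<in>{..<k}. (\<lambda>x. ip n x (u a)) -` {0}))"
    by (intro closed_Int closed_INT ballI closed_vimage closed_singleton continuous_on_bform_ip)
  ultimately have S: "compact S" using compact_Int_closed[OF K] by simp
  have norm: "\<exists>y\<in>S. \<forall>i<n. x i = sqrt (ip n x x) * y i"
    if "ip n x x > 0" "\<forall>a<k. ip n x (u a) = 0" for x
  proof -
    define c where "c = 1 / sqrt (ip n x x)"
    define y where "y = (\<lambda>i. if i < n then c * x i else 0)"
    have eq: "ip n y z = c * ip n x z" for z
      unfolding ip_scale_left[symmetric] by (simp add: ip_def y_def)
    have "ip n y y = c * (c * ip n x x)"
      by (subst eq, subst ip_commute, subst eq) simp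
    also have "\<dots> = 1" using that(1) by (simp add: c_def)
    finally have y1: "ip n y y = 1" .
    have "\<bar>y i\<bar> \<le> 1" if "i < n" for i
    proof -
      have "(y i)\<^sup>2 \<le> ip n y y"
        unfolding ip_def power2_eq_square using that by (intro member_le_sum) auto
      then show ?thesis by (simp add: y1 abs_square_le_1)
    qed
    then have "y \<in> K" by (auto simp: K_def y_def abs_le_iff)
    moreover have "x i = sqrt (ip n x x) * y i" if "i < n" for i
      using that \<open>ip n x x > 0\<close> by (simp add: y_def c_def)
    ultimately show ?thesis using y1 eq that(2) by (intro bexI[of _ y]) (auto simp: S_def)
  qed
  obtain x0 where "ip n x0 x0 > 0" "\<forall>a<k. ip n x0 (u a) = 0"
    using orthonormal_extend[OF assms] by blast
  with norm have "S \<noteq> {}" by blast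
  then obtain z where z: "z \<in> S" "\<And>y. y \<in> S \<Longrightarrow> bform n A y y \<le> bform n A z z"
    using continuous_attains_sup[OF S _ continuous_on_bform_ip(1)] by metis
  have "bform n A w w \<le> bform n A z z * ip n w w" if w: "\<forall>a<k. ip n w (u a) = 0" for w
  proof (cases "ip n w w = 0")
    case True
    then have "bform n A w w = 0" using ip_eq_0D[OF True] by (simp add: bform_def)
    then show ?thesis using True by simp
  next
    case False
    then have pos: "ip n w w > 0" using ip_nonneg[of n w] by simp
    then obtain y where y: "y \<in> S" "\<forall>i<n. w i = sqrt (ip n w w) * y i" using norm w by blast
    have "bform n A w w = bform n A (\<lambda>i. sqrt (ip n w w) * y i) (\<lambda>i. sqrt (ip n w w) * y i)"
      unfolding bform_def using y(2) by (intro sum.cong refl) auto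
    also have "\<dots> = ip n w w * bform n A y y" using pos by (simp add: bform_simps)
    also have "\<dots> \<le> ip n w w * bform n A z z" using z(2)[OF y(1)] pos by simp
    finally show ?thesis by (simp add: mult.commute)
  qed
  then show ?thesis using z(1) by (auto simp: S_def)
qed

lemma linear_le_quadratic_imp_0:
  fixes p r :: real
  assumes "\<And>t. 2 * t * p + t\<^sup>2 * r \<le> 0"
  shows "p = 0"
proof (rule ccontr)
  assume "p \<noteq> 0"
  define c where "c = \<bar>r\<bar> + 1"
  have c: "c > 0" "2 * c + r > 0" by (auto simp: c_def)
  have "2 * (p / c) * p = p\<^sup>2 * (2 * c / c\<^sup>2)" using c by (simp add: power2_eq_square)
  then have "2 * (p / c) * p + (p / c)\<^sup>2 * r = p\<^sup>2 * ((2 * c + r) / c\<^sup>2)"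
    by (simp add: power_divide add_divide_distrib distrib_left)
  moreover have "p\<^sup>2 * ((2 * c + r) / c\<^sup>2) > 0"
    using \<open>p \<noteq> 0\<close> c by simp
  ultimately show False using assms[of "p / c"] by simp
qed

text \<open>
  Orthonormal eigenvectors can be found one at a time: a maximizer \<open>z\<close> of the form on the
  orthogonal complement of those already found is another one.
\<close>

lemma orthonormal_eigenvectors:
  assumes A: "symmetric_on n A" and "k \<le> n"
  shows "\<exists>u l. (\<forall>a<k. \<forall>b<k. ip n (u a) (u b) = (if a = b then 1 else 0)) \<and>
     (\<forall>a<k. \<forall>i<n. (\<Sum>j<n. A i j * u a j) = l a * u a i)"
  using assms(2)
proof (induction k)
  case (Suc k)
  then obtain u l where u: "\<And>a b. a < k \<Longrightarrow> b < k \<Longrightarrow> ip n (u a) (u b) = (if a = b then 1 else 0)"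
    and l: "\<And>a i. a < k \<Longrightarrow> i < n \<Longrightarrow> (\<Sum>j<n. A i j * u a j) = l a * u a i"
    using Suc.IH by (metis Suc.prems Suc_leD)
  from Suc have "k < n" by simp
  obtain z where z: "ip n z z = 1" "\<And>a. a < k \<Longrightarrow> ip n z (u a) = 0"
    and max: "\<And>w. (\<forall>a<k. ip n w (u a) = 0) \<Longrightarrow> bform n A w w \<le> bform n A z z * ip n w w"
    using constrained_maximum[OF \<open>k < n\<close> u, where A = A] by blast
  define m where "m = bform n A z z"
  \<comment> \<open>The residual \<open>r\<close> lies in the orthogonal complement itself, so \<open>z + t r\<close> competes with \<open>z\<close>.\<close>
  define r where "r = (\<lambda>i. (\<Sum>j<n. A i j * z j) - m * z i)"
  have rip: "ip n r w = bform n A w z - m * ip n z w" for w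
    unfolding r_def ip_diff_left ip_scale_left bform_eq_ip by (simp add: ip_commute)
  have r_orth: "ip n r (u a) = 0" if "a < k" for a
  proof -
    have "bform n A (u a) z = ip n z (\<lambda>i. \<Sum>j<n. A i j * u a j)"
      by (subst bform_commute[OF A]) (simp only: bform_eq_ip)
    also have "\<dots> = ip n z (\<lambda>i. l a * u a i)"
      unfolding ip_def using l that by simp
    also have "\<dots> = 0" using z(2)[OF that]
      by (subst ip_commute) (simp add: ip_scale_left ip_commute)
    finally show ?thesis using z(2)[OF that] by (simp add: rip)
  qed
  have "2 * t * ip n r r + t\<^sup>2 * (bform n A r r - m * ip n r r) \<le> 0" for t
  proof -
    let ?w = "\<lambda>i. z i + t * r i"
    have "bform n A ?w ?w \<le> m * ip n ?w ?w"
      unfolding m_def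
      by (rule max) (use z(2) r_orth in \<open>simp add: ip_add_left ip_scale_left\<close>)
    moreover have "bform n A ?w ?w = m + 2 * t * bform n A r z + t\<^sup>2 * bform n A r r"
      by (simp add: bform_simps m_def power2_eq_square bform_commute[OF A, of z r] algebra_simps)
    moreover have "ip n ?w ?w = 1 + 2 * t * ip n z r + t\<^sup>2 * ip n r r"
      using z(1) by (simp add: ip_def power2_eq_square algebra_simps sum.distrib sum_distrib_left)
    moreover have "2 * t * (bform n A r z - m * ip n z r) + t\<^sup>2 * (bform n A r r - m * ip n r r)
        = (m + 2 * t * bform n A r z + t\<^sup>2 * bform n A r r) - m * (1 + 2 * t * ip n z r + t\<^sup>2 * ip n r r)"
      by (simp add: algebra_simps)
    ultimately show ?thesis by (subst rip) simp
  qed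
  then have "ip n r r = 0" by (rule linear_le_quadratic_imp_0)
  then have eig: "(\<Sum>j<n. A i j * z j) = m * z i" if "i < n" for i
    using ip_eq_0D[OF _ that] by (fastforce simp: r_def)
  have z': "ip n (u a) z = 0" if "a < k" for a using z(2)[OF that] by (simp add: ip_commute)
  let ?u = "u(k := z)" and ?l = "l(k := m)"
  have "\<forall>a<Suc k. \<forall>b<Suc k. ip n (?u a) (?u b) = (if a = b then 1 else 0)"
    using u z z' by (auto simp: less_Suc_eq)
  moreover have "\<forall>a<Suc k. \<forall>i<n. (\<Sum>j<n. A i j * ?u a j) = ?l a * ?u a i"
    using l eig by (auto simp: less_Suc_eq)
  ultimately show ?case by blast
qed simp

text \<open>
  The spectral theorem for real symmetric matrices, together with the fact that the eigenvalues
  are the roots of the characteristic polynomial, with the same multiplicities.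
\<close>

theorem spectral_decomposition:
  assumes A: "symmetric_on n A"
  obtains u l where "\<And>a b. a < n \<Longrightarrow> b < n \<Longrightarrow> ip n (u a) (u b) = (if a = b then 1 else 0)"
    and "\<And>a i. a < n \<Longrightarrow> i < n \<Longrightarrow> (\<Sum>j<n. A i j * u a j) = l a * u a i"
    and "\<And>x y. bform n A x y = (\<Sum>a<n. l a * ip n (u a) x * ip n (u a) y)"
    and "proots (char_poly (Matrix.mat n n (\<lambda>(i, j). A i j))) = image_mset l (mset_set {..<n})"
proof -
  obtain u l where u: "\<And>a b. a < n \<Longrightarrow> b < n \<Longrightarrow> ip n (u a) (u b) = (if a = b then 1 else 0)"
    and l: "\<And>a i. a < n \<Longrightarrow> i < n \<Longrightarrow> (\<Sum>j<n. A i j * u a j) = l a * u a i"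
    using orthonormal_eigenvectors[OF A order_refl] by blast
  define P where "P = Matrix.mat n n (\<lambda>(i, a). u a i)"
  define Q where "Q = Matrix.mat n n (\<lambda>(a, i). u a i)"
  define L where "L = Matrix.mat n n (\<lambda>(a, b). if a = b then l a else 0)"
  define M where "M = Matrix.mat n n (\<lambda>(i, j). A i j)"
  have carr [simp]: "P \<in> carrier_mat n n" "Q \<in> carrier_mat n n" "L \<in> carrier_mat n n" "M \<in> carrier_mat n n"
    by (auto simp: P_def Q_def L_def M_def)
  have QP: "Q * P = 1\<^sub>m n"
    by (rule eq_matI) (auto simp: Q_def P_def scalar_prod_def u ip_def[symmetric] atLeast0LessThan)
  then have PQ: "P * Q = 1\<^sub>m n" using mat_mult_left_right_inverse[of Q n P] by simp
  have complete: "(\<Sum>a<n. u a i * u a j) = (if i = j then 1 else 0)" if "i < n" "j < n" for i j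
  proof -
    have "(P * Q) $$ (i, j) = (\<Sum>a<n. u a i * u a j)"
      using that by (simp add: Q_def P_def scalar_prod_def atLeast0LessThan)
    then show ?thesis using PQ that by simp
  qed
  have MP: "M * P = P * L"
  proof (rule eq_matI)
    fix i a assume "i < dim_row (P * L)" "a < dim_col (P * L)"
    then have ia: "i < n" "a < n" by (auto simp: P_def L_def)
    then have "(M * P) $$ (i, a) = l a * u a i"
      by (simp add: M_def P_def scalar_prod_def atLeast0LessThan l)
    moreover have "(P * L) $$ (i, a) = l a * u a i"
      using ia by (simp add: L_def P_def scalar_prod_def atLeast0LessThan if_distrib cong: if_cong)
    ultimately show "(M * P) $$ (i, a) = (P * L) $$ (i, a)" by simp
  qed (auto simp: M_def P_def L_def)
  have "M = M * (P * Q)" by (simp only: PQ right_mult_one_mat[OF carr(4)])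
  also have "\<dots> = (M * P) * Q" by (rule assoc_mult_mat[symmetric]) (rule carr)+
  finally have "M = P * L * Q" by (simp only: MP)
  then have "similar_mat_wit M L P Q" by (intro similar_mat_witI[of P Q n] PQ QP carr)
  then have "similar_mat M L" unfolding similar_mat_def by blast
  then have "char_poly M = char_poly L" by (rule char_poly_similar)
  also have "\<dots> = (\<Prod>a\<leftarrow>diag_mat L. [:- a, 1:])"
    by (rule char_poly_upper_triangular[of _ n]) (auto simp: L_def upper_triangular_def)
  also have "diag_mat L = map l [0..<n]"
    by (auto simp: diag_mat_def L_def)
  also have "(\<Prod>a\<leftarrow>map l [0..<n]. [:- a, 1:]) = (\<Prod>a<n. [:- l a, 1:])"
    by (simp add: o_def atLeast0LessThan flip: prod.list_conv_set_nth prod.distinct_set_conv_list)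
  finally have "proots (char_poly M) = (\<Sum>a<n. proots [:- l a, 1:])"
    by (simp add: proots_prod)
  also have "\<dots> = image_mset l (mset_set {..<n})"
    by (induction n) (simp_all add: lessThan_Suc)
  finally have cp: "proots (char_poly M) = image_mset l (mset_set {..<n})" .
  have expand: "y j = (\<Sum>a<n. ip n (u a) y * u a j)" if "j < n" for y j
  proof -
    have "(\<Sum>a<n. ip n (u a) y * u a j) = (\<Sum>i<n. y i * (\<Sum>a<n. u a i * u a j))"
      unfolding ip_def sum_distrib_right sum_distrib_left by (subst sum.swap) (simp add: mult_ac)
    also have "\<dots> = (\<Sum>i<n. if i = j then y i else 0)"
      using complete that by (intro sum.cong) auto
    finally show ?thesis using that by simp
  qed
  have "bform n A x y = (\<Sum>a<n. l a * ip n (u a) x * ip n (u a) y)" for x y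
  proof -
    have Ay: "(\<Sum>j<n. A i j * y j) = (\<Sum>a<n. ip n (u a) y * (l a * u a i))" if "i < n" for i
    proof -
      have "(\<Sum>j<n. A i j * y j) = (\<Sum>j<n. A i j * (\<Sum>a<n. ip n (u a) y * u a j))"
        using expand[of _ y] by (intro sum.cong) auto
      also have "\<dots> = (\<Sum>a<n. ip n (u a) y * (\<Sum>j<n. A i j * u a j))"
        unfolding sum_distrib_left by (subst sum.swap) (simp add: mult_ac)
      finally show ?thesis using l that by simp
    qed
    have "bform n A x y = ip n (\<lambda>i. \<Sum>a<n. ip n (u a) y * (l a * u a i)) x"
      unfolding bform_eq_ip ip_commute[of n x] using Ay by (simp add: ip_def)
    also have "\<dots> = (\<Sum>a<n. l a * ip n (u a) x * ip n (u a) y)"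
      by (simp only: ip_sum_left ip_scale_left) (simp only: mult_ac)
    finally show ?thesis .
  qed
  with u l cp[unfolded M_def] show ?thesis by (intro that) assumption+
qed

section \<open>The reverse Cauchy--Schwarz inequality\<close>

text \<open>
  The form \<open>A\<close> has at most one positive eigenvalue, in a formulation that mentions no eigenvalues.
\<close>

definition reverse_CS :: "nat \<Rightarrow> (nat \<Rightarrow> nat \<Rightarrow> real) \<Rightarrow> bool" where
  "reverse_CS n A \<longleftrightarrow>
     (\<forall>x y. bform n A x x > 0 \<longrightarrow> bform n A x x * bform n A y y \<le> (bform n A x y)\<^sup>2)"

lemma reverse_CS_if_nonpos_on_hyperplane:
  assumes A: "symmetric_on n A" and h: "\<And>x. ip n h x = 0 \<Longrightarrow> bform n A x x \<le> 0"
  shows "reverse_CS n A"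
  unfolding reverse_CS_def
proof (intro allI impI)
  fix x y assume pos: "bform n A x x > 0"
  then have hx: "ip n h x \<noteq> 0" using h[of x] by auto
  define s where "s = - (ip n h y / ip n h x)"
  have "ip n h (\<lambda>i. y i + s * x i) = 0"
    unfolding ip_add_right ip_scale_right using hx by (simp add: s_def)
  from h[OF this] have *: "bform n A y y + 2 * s * bform n A x y + s\<^sup>2 * bform n A x x \<le> 0"
    by (simp add: bform_simps bform_commute[OF A, of y x] power2_eq_square algebra_simps)
  have "bform n A x x * bform n A y y - (bform n A x y)\<^sup>2 \<le>
      bform n A x x * bform n A y y - (bform n A x y)\<^sup>2 + (bform n A x y + s * bform n A x x)\<^sup>2"
    by simp
  also have "\<dots> = bform n A x x * (bform n A y y + 2 * s * bform n A x y + s\<^sup>2 * bform n A x x)"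
    by (simp add: power2_eq_square algebra_simps)
  also have "\<dots> \<le> 0" using * pos by (simp add: mult_nonneg_nonpos)
  finally show "bform n A x x * bform n A y y \<le> (bform n A x y)\<^sup>2" by simp
qed

lemma sum_swap_pairs:
  fixes F :: "nat \<Rightarrow> nat \<Rightarrow> nat \<Rightarrow> nat \<Rightarrow> real"
  shows "(\<Sum>i<n. \<Sum>j<n. \<Sum>a<n. \<Sum>b<n. F i j a b) = (\<Sum>a<n. \<Sum>b<n. \<Sum>i<n. \<Sum>j<n. F i j a b)"
proof -
  have "(\<Sum>i<n. \<Sum>j<n. \<Sum>a<n. \<Sum>b<n. F i j a b) = (\<Sum>i<n. \<Sum>a<n. \<Sum>j<n. \<Sum>b<n. F i j a b)"
    by (intro sum.cong refl sum.swap)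
  also have "\<dots> = (\<Sum>a<n. \<Sum>i<n. \<Sum>j<n. \<Sum>b<n. F i j a b)"
    by (rule sum.swap)
  also have "\<dots> = (\<Sum>a<n. \<Sum>i<n. \<Sum>b<n. \<Sum>j<n. F i j a b)"
    by (intro sum.cong refl sum.swap)
  also have "\<dots> = (\<Sum>a<n. \<Sum>b<n. \<Sum>i<n. \<Sum>j<n. F i j a b)"
    by (intro sum.cong refl sum.swap)
  finally show ?thesis .
qed

lemma bform_congruence:
  "bform n (\<lambda>i j. \<Sum>a<n. \<Sum>b<n. V i a * V j b * A a b) x y =
   bform n A (\<lambda>a. \<Sum>i<n. V i a * x i) (\<lambda>a. \<Sum>i<n. V i a * y i)"
proof -
  have alt: "bform n A X Y = (\<Sum>a<n. \<Sum>b<n. A a b * (X a * Y b))" for X Y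
    by (simp add: bform_def mult.assoc)
  have "bform n (\<lambda>i j. \<Sum>a<n. \<Sum>b<n. V i a * V j b * A a b) x y =
      (\<Sum>i<n. \<Sum>j<n. \<Sum>a<n. \<Sum>b<n. A a b * ((V i a * x i) * (V j b * y j)))"
    unfolding bform_def sum_distrib_right by (intro sum.cong refl) (simp only: mult_ac)
  also have "\<dots> = (\<Sum>a<n. \<Sum>b<n. \<Sum>i<n. \<Sum>j<n. A a b * ((V i a * x i) * (V j b * y j)))"
    by (rule sum_swap_pairs)
  also have "\<dots> = bform n A (\<lambda>a. \<Sum>i<n. V i a * x i) (\<lambda>a. \<Sum>i<n. V i a * y i)"
    unfolding alt sum_product unfolding sum_distrib_left by (rule refl)
  finally show ?thesis .
qed

lemma reverse_CS_congruence:
  "reverse_CS n A \<Longrightarrow> reverse_CS n (\<lambda>i j. \<Sum>a<n. \<Sum>b<n. V i a * V j b * A a b)"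
  unfolding reverse_CS_def bform_congruence by blast

lemma bform_cong: "(\<And>i j. i < n \<Longrightarrow> j < n \<Longrightarrow> A i j = B i j) \<Longrightarrow> bform n A x y = bform n B x y"
  by (simp add: bform_def)

lemma reverse_CS_cong:
  "(\<And>i j. i < n \<Longrightarrow> j < n \<Longrightarrow> A i j = B i j) \<Longrightarrow> reverse_CS n A = reverse_CS n B"
  unfolding reverse_CS_def by (simp add: bform_cong[of n A B])

lemma reverse_CS_scale:
  assumes "reverse_CS n A"
  shows "reverse_CS n (\<lambda>i j. w i * w j * A i j)"
proof -
  have "reverse_CS n (\<lambda>i j. \<Sum>a<n. \<Sum>b<n. (if i = a then w i else 0) * (if j = b then w j else 0) * A a b)"
    by (rule reverse_CS_congruence[OF assms])
  also have "?this \<longleftrightarrow> ?thesis"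
    by (rule reverse_CS_cong) (simp add: if_distrib[of "\<lambda>c. c * _"] if_distrib[of "\<lambda>c. _ * c"] cong: if_cong)
  finally show ?thesis .
qed

lemma tendsto_bform:
  assumes "\<And>i j. i < n \<Longrightarrow> j < n \<Longrightarrow> ((\<lambda>m. A m i j) \<longlongrightarrow> B i j) F"
  shows "((\<lambda>m. bform n (A m) x y) \<longlongrightarrow> bform n B x y) F"
  unfolding bform_def by (intro tendsto_intros assms) auto

lemma reverse_CS_limit:
  assumes "\<And>m::nat. reverse_CS n (A m)"
    and lim: "\<And>i j. i < n \<Longrightarrow> j < n \<Longrightarrow> (\<lambda>m. A m i j) \<longlonglongrightarrow> B i j"
  shows "reverse_CS n B"
  unfolding reverse_CS_def
proof (intro allI impI)
  fix x y assume pos: "bform n B x x > 0"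
  note t = tendsto_bform[OF lim]
  have "\<forall>\<^sub>F m in sequentially. bform n (A m) x x > 0"
    using order_tendstoD(1)[OF t pos] .
  then have "\<forall>\<^sub>F m in sequentially.
      bform n (A m) x x * bform n (A m) y y \<le> (bform n (A m) x y)\<^sup>2"
    by eventually_elim (use assms(1) in \<open>auto simp: reverse_CS_def\<close>)
  then show "bform n B x x * bform n B y y \<le> (bform n B x y)\<^sup>2"
    by (intro tendsto_le[OF _ tendsto_power[OF t] tendsto_mult[OF t t]]) auto
qed

lemma reverse_CS_if_one_pos_eigenvalue:
  assumes A: "symmetric_on n A"
    and Q: "\<And>x y. bform n A x y = (\<Sum>a<n. l a * ip n (u a) x * ip n (u a) y)"
    and l: "\<And>a b. a < n \<Longrightarrow> b < n \<Longrightarrow> l a > 0 \<Longrightarrow> l b > 0 \<Longrightarrow> a = b"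
  shows "reverse_CS n A"
proof -
  have "\<exists>h. \<forall>a<n. l a > 0 \<longrightarrow> u a = h" using l by (metis)
  then obtain h where h: "\<And>a. a < n \<Longrightarrow> l a > 0 \<Longrightarrow> u a = h" by blast
  have "bform n A x x \<le> 0" if "ip n h x = 0" for x
    unfolding Q
  proof (rule sum_nonpos)
    fix a assume "a \<in> {..<n}"
    then show "l a * ip n (u a) x * ip n (u a) x \<le> 0"
      using h[of a] that by (cases "l a > 0") (auto simp: mult.assoc mult_nonpos_nonneg)
  qed
  then show ?thesis by (rule reverse_CS_if_nonpos_on_hyperplane[OF A])
qed

lemma size_filter_image_mset_set:
  fixes n :: nat
  shows "size (filter_mset P (image_mset l (mset_set {..<n}))) = card {a. a < n \<and> P (l a)}"
proof -
  have "filter_mset (\<lambda>a. P (l a)) (mset_set {..<n}) = mset_set {a \<in> {..<n}. P (l a)}"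
    by (rule filter_mset_mset_set) simp
  then show ?thesis by (simp add: filter_mset_image_mset)
qed

lemma reverse_CS_if_num_pos_eigenvalues:
  assumes A: "symmetric_on n A" and "num_pos_eigenvalues (Matrix.mat n n (\<lambda>(i, j). A i j)) = 1"
  shows "reverse_CS n A"
proof -
  obtain u l where Q: "\<And>x y. bform n A x y = (\<Sum>a<n. l a * ip n (u a) x * ip n (u a) y)"
    and "proots (char_poly (Matrix.mat n n (\<lambda>(i, j). A i j))) = image_mset l (mset_set {..<n})"
    by (rule spectral_decomposition[OF A]) blast
  with assms(2) have "card {a. a < n \<and> l a > 0} = 1"
    by (simp add: num_pos_eigenvalues_def size_filter_image_mset_set)
  then obtain c where "{a. a < n \<and> l a > 0} = {c}" using card_1_singletonE by blast
  then have c: "a = c" if "a < n" "l a > 0" for a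
    using that by (auto simp: set_eq_iff)
  show ?thesis
    by (rule reverse_CS_if_one_pos_eigenvalue[OF A Q]) (use c in auto)
qed

text \<open>
  A form that is positive somewhere and negative definite on a hyperplane has signature
  \<open>(1, n - 1)\<close>.
\<close>

lemma lorentzian_signature_eigenvalues:
  assumes A: "symmetric_on n A" and w: "bform n A w w > 0"
    and neg: "\<And>x. ip n h x = 0 \<Longrightarrow> \<exists>i<n. x i \<noteq> 0 \<Longrightarrow> bform n A x x < 0"
  shows "num_pos_eigenvalues (Matrix.mat n n (\<lambda>(i, j). A i j)) = 1"
    and "num_neg_eigenvalues (Matrix.mat n n (\<lambda>(i, j). A i j)) = n - 1"
proof -
  obtain u l where on: "\<And>a b. a < n \<Longrightarrow> b < n \<Longrightarrow> ip n (u a) (u b) = (if a = b then 1 else 0)"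
    and Q: "\<And>x y. bform n A x y = (\<Sum>a<n. l a * ip n (u a) x * ip n (u a) y)"
    and roots: "proots (char_poly (Matrix.mat n n (\<lambda>(i, j). A i j))) = image_mset l (mset_set {..<n})"
    by (rule spectral_decomposition[OF A]) blast
  obtain c where c: "c < n" "l c > 0"
  proof -
    have "\<exists>c<n. l c > 0"
    proof (rule ccontr)
      assume "\<not> ?thesis"
      then have "l a \<le> 0" if "a < n" for a using that by (meson not_le)
      then have "bform n A w w \<le> 0"
        unfolding Q by (intro sum_nonpos) (simp add: mult.assoc mult_nonpos_nonneg)
      with w show False by simp
    qed
    then show ?thesis using that by blast
  qed
  have l_neg: "l b < 0" if b: "b < n" "b \<noteq> c" for b
  proof (rule ccontr)
    assume "\<not> l b < 0"
    \<comment> \<open>A nonzero combination of \<open>u c\<close> and \<open>u b\<close> on which \<open>h\<close> vanishes.\<close>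
    define p q where "p = (if ip n h (u c) = 0 \<and> ip n h (u b) = 0 then 1 else ip n h (u b))"
      and "q = - (if ip n h (u c) = 0 \<and> ip n h (u b) = 0 then 1 else ip n h (u c))"
    define x where "x = (\<lambda>i. p * u c i + q * u b i)"
    have ipx: "ip n (u a) x = p * ip n (u a) (u c) + q * ip n (u a) (u b)" for a
      by (simp add: x_def ip_add_right ip_scale_right)
    have "ip n x x = p\<^sup>2 + q\<^sup>2"
      using b c by (subst x_def) (simp add: ip_add_left ip_scale_left ipx on power2_eq_square)
    moreover have "p\<^sup>2 + q\<^sup>2 > 0" by (auto simp: p_def q_def sum_power2_gt_zero_iff)
    ultimately have "\<exists>i<n. x i \<noteq> 0" by (force simp: ip_def intro: ccontr)
    moreover have "ip n h x = 0"
      unfolding x_def ip_add_right ip_scale_right by (simp add: p_def q_def)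
    ultimately have "bform n A x x < 0" using neg by blast
    moreover have "bform n A x x \<ge> 0"
      unfolding Q
    proof (rule sum_nonneg)
      fix a assume "a \<in> {..<n}"
      then show "l a * ip n (u a) x * ip n (u a) x \<ge> 0"
        using b c \<open>\<not> l b < 0\<close> by (cases "a = b \<or> a = c") (auto simp: ipx on mult.assoc)
    qed
    ultimately show False by simp
  qed
  have "{a. a < n \<and> l a > 0} = {c}" "{a. a < n \<and> l a < 0} = {..<n} - {c}"
    using c l_neg by (force dest: order.asym)+
  then show "num_pos_eigenvalues (Matrix.mat n n (\<lambda>(i, j). A i j)) = 1"
    "num_neg_eigenvalues (Matrix.mat n n (\<lambda>(i, j). A i j)) = n - 1"
    using c by (simp_all add: num_pos_eigenvalues_def num_neg_eigenvalues_def roots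
        size_filter_image_mset_set)
qed

text \<open>
  In the application \<open>T l\<close> is the Hessian of the \<open>l\<close>-th partial derivative of a cubic form \<open>g\<close>, and
  \<open>H\<close> is the Hessian of the derivative of \<open>g\<close> in the direction \<open>v\<close>.  By the symmetry of \<open>T\<close>, pairing
  \<open>v\<close> with \<open>x\<close> in \<open>T i\<close> gives the \<open>i\<close>-th coordinate of \<open>H x\<close>, and the reverse Cauchy--Schwarz
  inequality for \<open>T i\<close> bounds the value of \<open>T i\<close> at \<open>x\<close>.  If \<open>Hv i = 0\<close>, then \<open>T i\<close> vanishes and
  the quotient by \<open>Hv i\<close> is \<open>0\<close> by convention.
\<close>

lemma bform_le_weighted_square:
  assumes sym: "\<And>l i j. l < n \<Longrightarrow> i < n \<Longrightarrow> j < n \<Longrightarrow> T l i j = T i l j"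
    and nonneg: "\<And>l i j. l < n \<Longrightarrow> i < n \<Longrightarrow> j < n \<Longrightarrow> T l i j \<ge> (0::real)"
    and v: "\<And>l. l < n \<Longrightarrow> v l > 0"
    and T: "\<And>l. l < n \<Longrightarrow> reverse_CS n (T l)"
    and H: "H = (\<lambda>i j. \<Sum>l<n. v l * T l i j)"
    and Hv: "Hv = (\<lambda>i. \<Sum>j<n. H i j * v j)"
  shows "bform n H x x \<le> (\<Sum>i<n. v i * ((\<Sum>j<n. H i j * x j)\<^sup>2 / Hv i))"
proof -
  have row: "bform n (T i) v y = (\<Sum>j<n. H i j * y j)" if "i < n" for i y
  proof -
    have "bform n (T i) v y = (\<Sum>j<n. \<Sum>l<n. T i l j * v l * y j)"
      unfolding bform_def by (rule sum.swap)
    also have "\<dots> = (\<Sum>j<n. \<Sum>l<n. v l * T l i j * y j)"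
      using sym that by (intro sum.cong refl) auto
    finally show ?thesis unfolding H by (simp add: sum_distrib_right)
  qed
  have "bform n H x x = (\<Sum>i<n. \<Sum>j<n. \<Sum>l<n. v l * (T l i j * x i * x j))"
    unfolding bform_def H by (simp add: sum_distrib_left sum_distrib_right mult_ac)
  also have "\<dots> = (\<Sum>i<n. \<Sum>l<n. \<Sum>j<n. v l * (T l i j * x i * x j))"
    by (subst (2) sum.swap) simp
  also have "\<dots> = (\<Sum>l<n. \<Sum>i<n. \<Sum>j<n. v l * (T l i j * x i * x j))"
    by (rule sum.swap)
  also have "\<dots> = (\<Sum>l<n. v l * bform n (T l) x x)"
    by (simp add: bform_def sum_distrib_left)
  also have "\<dots> \<le> (\<Sum>i<n. v i * ((\<Sum>j<n. H i j * x j)\<^sup>2 / Hv i))"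
  proof (rule sum_mono)
    fix i assume "i \<in> {..<n}"
    then have i: "i < n" by simp
    have hv: "bform n (T i) v v = Hv i" using row[OF i] Hv by simp
    have terms: "T i j k * v j * v k \<ge> 0" if "j < n" "k < n" for j k
      using nonneg[OF i that] v that by (simp add: less_imp_le)
    show "v i * bform n (T i) x x \<le> v i * ((\<Sum>j<n. H i j * x j)\<^sup>2 / Hv i)"
    proof (cases "Hv i > 0")
      case True
      then have "Hv i * bform n (T i) x x \<le> (\<Sum>j<n. H i j * x j)\<^sup>2"
        using T[OF i] row[OF i] hv unfolding reverse_CS_def by metis
      then show ?thesis using True v[OF i] by (simp add: field_simps)
    next
      case False
      have "Hv i \<ge> 0" unfolding hv[symmetric] bform_def using terms by (intro sum_nonneg) auto
      with False have 0: "bform n (T i) v v = 0" using hv by simp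
      have "T i j k = 0" if "j < n" "k < n" for j k
      proof -
        have "(\<Sum>k<n. T i j k * v j * v k) = 0"
          using 0 terms that(1) unfolding bform_def
          by (subst (asm) sum_nonneg_eq_0_iff) (auto intro: sum_nonneg)
        then have "T i j k * v j * v k = 0"
          using terms that by (subst (asm) sum_nonneg_eq_0_iff) auto
        then show ?thesis using v that by fastforce
      qed
      then have "bform n (T i) x x = 0" by (simp add: bform_def)
      moreover have "Hv i = 0" using 0 hv by simp
      ultimately show ?thesis by simp
    qed
  qed
  finally show ?thesis .
qed

lemma laplacian_identity:
  assumes H: "symmetric_on n H" and v: "\<And>i. i < n \<Longrightarrow> v i \<noteq> 0"
  shows "(\<Sum>i<n. \<Sum>j<n. H i j * v i * v j * (x i / v i - x j / v j)\<^sup>2) =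
     2 * (\<Sum>i<n. (\<Sum>j<n. H i j * v j) * (x i)\<^sup>2 / v i) - 2 * bform n H x x"
proof -
  have "(\<Sum>i<n. \<Sum>j<n. H i j * v i * v j * (x i / v i - x j / v j)\<^sup>2) =
      (\<Sum>i<n. \<Sum>j<n. H i j * v j * (x i)\<^sup>2 / v i + H i j * v i * (x j)\<^sup>2 / v j - 2 * (H i j * x i * x j))"
    using v by (intro sum.cong refl) (simp add: field_simps power2_eq_square)
  also have "\<dots> = (\<Sum>i<n. \<Sum>j<n. H i j * v j * (x i)\<^sup>2 / v i)
      + (\<Sum>i<n. \<Sum>j<n. H i j * v i * (x j)\<^sup>2 / v j) - 2 * bform n H x x"
    by (simp add: sum.distrib sum_subtractf bform_def sum_distrib_left)
  also have "(\<Sum>i<n. \<Sum>j<n. H i j * v i * (x j)\<^sup>2 / v j) = (\<Sum>i<n. \<Sum>j<n. H i j * v j * (x i)\<^sup>2 / v i)"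
    by (subst sum.swap) (use H in \<open>intro sum.cong refl, auto simp: symmetric_on_def\<close>)
  finally show ?thesis by (simp add: sum_distrib_right sum_divide_distrib)
qed

text \<open>
  Let \<open>D\<close> be the diagonal matrix with \<open>D v = H v\<close>.  For an eigenvector \<open>x\<close> of the pencil
  \<open>H x = \<lambda> D x\<close> with \<open>\<lambda> > 0\<close> \<open>bform_le_weighted_square\<close> gives \<open>\<lambda> \<le> \<lambda>\<^sup>2\<close>, hence \<open>\<lambda> \<ge> 1\<close>, while
  \<open>D - H\<close> is a weighted graph Laplacian and therefore \<open>\<lambda> \<le> 1\<close>.  Equality in the Laplacian estimate
  makes \<open>x / v\<close> constant along the edges of the graph, so \<open>x\<close> is a multiple of \<open>v\<close> if the graph is
  connected.  The assumption \<open>conn\<close> demands connectedness in a strong form, and only for the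
  indices with nonzero rows.
\<close>

proposition reverse_CS_local_to_global:
  assumes sym: "\<And>l i j. l < n \<Longrightarrow> i < n \<Longrightarrow> j < n \<Longrightarrow> T l i j = T i l j"
      "\<And>l i j. l < n \<Longrightarrow> i < n \<Longrightarrow> j < n \<Longrightarrow> T l i j = T l j i"
    and nonneg: "\<And>l i j. l < n \<Longrightarrow> i < n \<Longrightarrow> j < n \<Longrightarrow> T l i j \<ge> (0::real)"
    and v: "\<And>l. l < n \<Longrightarrow> v l > 0"
    and T: "\<And>l. l < n \<Longrightarrow> reverse_CS n (T l)"
    and H: "H = (\<lambda>i j. \<Sum>l<n. v l * T l i j)"
    and conn: "\<And>i j k m. i < n \<Longrightarrow> j < n \<Longrightarrow> i \<noteq> j \<Longrightarrow> k < n \<Longrightarrow> m < n \<Longrightarrow> H i k > 0 \<Longrightarrow> H j m > 0 \<Longrightarrow>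
       H i j > 0 \<or> (\<exists>a<n. H i a > 0 \<and> H j a > 0)"
  shows "reverse_CS n H"
proof -
  define Hv where "Hv = (\<lambda>i. \<Sum>j<n. H i j * v j)"
  have Hv_eq: "(\<Sum>j<n. H i j * v j) = Hv i" for i by (simp add: Hv_def)
  have H_sym: "symmetric_on n H" unfolding H symmetric_on_def using sym(2) by simp
  have H_nonneg: "H i j \<ge> 0" if "i < n" "j < n" for i j
    unfolding H using that nonneg v by (intro sum_nonneg) (simp add: less_imp_le)
  have Hv_nonneg: "Hv i \<ge> 0" if "i < n" for i
    unfolding Hv_def using that H_nonneg v by (intro sum_nonneg) (simp add: less_imp_le)
  have null: "H i j = 0" if "i < n" "Hv i = 0" "j < n" for i j
  proof -
    have "H i j * v j = 0"
      using that H_nonneg v unfolding Hv_def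
      by (subst (asm) sum_nonneg_eq_0_iff) (auto simp: less_imp_le)
    then show ?thesis using v[OF that(3)] by simp
  qed
  \<comment> \<open>Rows of \<open>H\<close> that vanish get weight \<open>1\<close>, so that \<open>D\<close> is invertible.\<close>
  define D where "D = (\<lambda>i. if Hv i > 0 then Hv i / v i else 1)"
  have D: "D i > 0" if "i < n" for i using v[OF that] by (simp add: D_def)
  define s where "s = (\<lambda>i. sqrt (D i))"
  have s: "s i > 0" "s i * s i = D i" if "i < n" for i
    using D[OF that] by (simp_all add: s_def)
  define B where "B = (\<lambda>i j. H i j / (s i * s j))"
  have B_sym: "symmetric_on n B"
    using H_sym unfolding B_def symmetric_on_def by (simp add: mult.commute)
  obtain u l where on: "\<And>a b. a < n \<Longrightarrow> b < n \<Longrightarrow> ip n (u a) (u b) = (if a = b then 1 else 0)"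
    and eig: "\<And>a i. a < n \<Longrightarrow> i < n \<Longrightarrow> (\<Sum>j<n. B i j * u a j) = l a * u a i"
    and Q: "\<And>x y. bform n B x y = (\<Sum>a<n. l a * ip n (u a) x * ip n (u a) y)"
    by (rule spectral_decomposition[OF B_sym]) blast
  have shape: "\<exists>k. \<forall>i<n. u a i / s i = (if Hv i > 0 then k * v i else 0)"
    if a: "a < n" "l a > 0" for a
  proof -
    define x where "x = (\<lambda>i. u a i / s i)"
    have ux: "u a i = s i * x i" if "i < n" for i using s[OF that] by (simp add: x_def)
    have Hx: "(\<Sum>j<n. H i j * x j) = l a * D i * x i" if i: "i < n" for i
    proof -
      have "(\<Sum>j<n. H i j * x j) = s i * (\<Sum>j<n. B i j * u a j)"
        unfolding sum_distrib_left
        using s(1)[OF i] by (intro sum.cong refl) (simp add: B_def x_def)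
      also have "\<dots> = l a * D i * x i"
        using eig[OF a(1) i] s(2)[OF i] ux[OF i] by (simp add: mult_ac)
      finally show ?thesis .
    qed
    have x0: "x i = 0" if "i < n" "\<not> Hv i > 0" for i
    proof -
      have "Hv i = 0" using that Hv_nonneg[OF that(1)] by simp
      then have "(\<Sum>j<n. H i j * x j) = 0" using null that by simp
      then show ?thesis using Hx[OF that(1)] a D[OF that(1)] by simp
    qed
    have norm: "(\<Sum>i<n. D i * (x i)\<^sup>2) = 1"
    proof -
      have "(\<Sum>i<n. D i * (x i)\<^sup>2) = ip n (u a) (u a)"
        unfolding ip_def using ux s(2)[symmetric] by (intro sum.cong refl) (simp add: power2_eq_square)
      then show ?thesis using on a by simp
    qed
    have Qx: "bform n H x x = l a"
    proof -
      have "bform n H x x = (\<Sum>i<n. l a * (D i * (x i)\<^sup>2))"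
        unfolding bform_eq_ip ip_def using Hx by (intro sum.cong refl) (simp add: power2_eq_square)
      then show ?thesis using norm by (simp flip: sum_distrib_left)
    qed
    have "l a \<le> (\<Sum>i<n. v i * ((\<Sum>j<n. H i j * x j)\<^sup>2 / Hv i))"
      unfolding Qx[symmetric] by (rule bform_le_weighted_square[OF sym(1) nonneg v T H Hv_def])
    also have "\<dots> = (\<Sum>i<n. (l a)\<^sup>2 * (D i * (x i)\<^sup>2))"
    proof (intro sum.cong refl)
      fix i assume "i \<in> {..<n}"
      then show "v i * ((\<Sum>j<n. H i j * x j)\<^sup>2 / Hv i) = (l a)\<^sup>2 * (D i * (x i)\<^sup>2)"
        using v[of i] x0[of i] by (cases "Hv i > 0") (auto simp: Hx D_def power2_eq_square)
    qed
    also have "\<dots> = (l a)\<^sup>2" using norm by (simp flip: sum_distrib_left)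
    finally have "l a \<ge> 1" using a(2) by (simp add: power2_eq_square)
    have "(\<Sum>i<n. Hv i * (x i)\<^sup>2 / v i) = (\<Sum>i<n. D i * (x i)\<^sup>2)"
      using x0 by (intro sum.cong refl) (auto simp: D_def)
    then have lap: "(\<Sum>i<n. \<Sum>j<n. H i j * v i * v j * (x i / v i - x j / v j)\<^sup>2) \<le> 0"
      using laplacian_identity[OF H_sym, of v x] v \<open>l a \<ge> 1\<close> norm Qx
      by (simp add: less_imp_neq[symmetric] Hv_eq)
    have edge: "x i / v i = x j / v j" if ij: "i < n" "j < n" "H i j > 0" for i j
    proof (rule ccontr)
      assume "x i / v i \<noteq> x j / v j"
      then have "0 < H i j * v i * v j * (x i / v i - x j / v j)\<^sup>2"
        using ij v by simp
      also have "\<dots> \<le> (\<Sum>j<n. H i j * v i * v j * (x i / v i - x j / v j)\<^sup>2)"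
        using ij v H_nonneg by (intro member_le_sum) (auto simp: less_imp_le)
      also have "\<dots> \<le> (\<Sum>i<n. \<Sum>j<n. H i j * v i * v j * (x i / v i - x j / v j)\<^sup>2)"
        using ij v H_nonneg
        by (intro member_le_sum[where f = "\<lambda>i. \<Sum>j<n. H i j * v i * v j * (x i / v i - x j / v j)\<^sup>2"])
          (auto simp: less_imp_le intro!: sum_nonneg)
      finally show False using lap by simp
    qed
    have const: "x i / v i = x j / v j" if ij: "i < n" "j < n" "Hv i > 0" "Hv j > 0" for i j
    proof (cases "i = j")
      case False
      have "\<exists>k<n. H i k > 0" if "i < n" "Hv i > 0" for i
      proof (rule ccontr)
        assume "\<not> ?thesis"
        then have "H i k \<le> 0" if "k < n" for k using that by (meson not_le)
        then have "Hv i \<le> 0" unfolding Hv_def using v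
          by (intro sum_nonpos) (simp add: mult_nonpos_nonneg less_imp_le)
        with that show False by simp
      qed
      then obtain k m where "k < n" "H i k > 0" "m < n" "H j m > 0" using ij by meson
      then have "H i j > 0 \<or> (\<exists>a<n. H i a > 0 \<and> H j a > 0)" using conn ij False by blast
      then show ?thesis using edge ij by metis
    qed simp
    show ?thesis
    proof (cases "\<exists>i<n. Hv i > 0")
      case True
      then obtain r where r: "r < n" "Hv r > 0" by blast
      have "x i = x r / v r * v i" if "i < n" "Hv i > 0" for i
        using const[OF that(1) r(1) that(2) r(2)] v[OF that(1)] by (simp add: field_simps)
      with x0 have "\<forall>i<n. x i = (if Hv i > 0 then x r / v r * v i else 0)" by auto
      then show ?thesis unfolding x_def by blast
    qed (use x0 in \<open>auto simp: x_def\<close>)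
  qed
  have uniq: "a = b" if ab: "a < n" "b < n" "l a > 0" "l b > 0" for a b
  proof (rule ccontr)
    assume "a \<noteq> b"
    obtain p q where p: "\<And>i. i < n \<Longrightarrow> u a i / s i = (if Hv i > 0 then p * v i else 0)"
      and q: "\<And>i. i < n \<Longrightarrow> u b i / s i = (if Hv i > 0 then q * v i else 0)"
      using shape ab by meson
    define z where "z = (\<lambda>i. s i * (if Hv i > 0 then v i else 0))"
    have "u a i = p * z i" "u b i = q * z i" if "i < n" for i
      using p[OF that] q[OF that] s(1)[OF that] by (auto simp: z_def field_simps split: if_splits)
    then have eq: "ip n (u a) (u a) = p * p * ip n z z" "ip n (u b) (u b) = q * q * ip n z z"
      "ip n (u a) (u b) = p * q * ip n z z"
      by (simp_all add: ip_def sum_distrib_left mult_ac)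
    have "p * p * ip n z z = 1" "q * q * ip n z z = 1" "p * q * ip n z z = 0"
      using eq on[OF ab(1) ab(1)] on[OF ab(2) ab(2)] on[OF ab(1) ab(2)] \<open>a \<noteq> b\<close> by simp_all
    then show False by auto
  qed
  have "reverse_CS n (\<lambda>i j. s i * s j * B i j)"
    by (intro reverse_CS_scale reverse_CS_if_one_pos_eigenvalue[OF B_sym Q uniq])
  also have "?this \<longleftrightarrow> ?thesis"
    by (rule reverse_CS_cong) (use s(1) in \<open>force simp: B_def\<close>)
  finally show ?thesis .
qed

section \<open>Forms satisfying a four-point condition\<close>

lemma quadratic_sum_insert:
  fixes s :: "nat \<Rightarrow> nat \<Rightarrow> real"
  assumes "finite Y" "c \<notin> Y" and sym: "\<And>j. j \<in> Y \<Longrightarrow> s j c = s c j"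
  shows "(\<Sum>i\<in>insert c Y. \<Sum>j\<in>insert c Y. s i j * g i * g j) =
    s c c * (g c)\<^sup>2 + 2 * g c * (\<Sum>j\<in>Y. s c j * g j) + (\<Sum>i\<in>Y. \<Sum>j\<in>Y. s i j * g i * g j)"
proof -
  have "(\<Sum>i\<in>Y. s i c * g i * g c) = g c * (\<Sum>j\<in>Y. s c j * g j)"
    unfolding sum_distrib_left by (intro sum.cong refl) (simp add: sym)
  moreover have "(\<Sum>j\<in>Y. s c c * 0 + s c j * g c * g j) = g c * (\<Sum>j\<in>Y. s c j * g j)"
    unfolding sum_distrib_left by (intro sum.cong refl) simp
  ultimately show ?thesis
    using assms(1,2) by (simp add: sum.distrib power2_eq_square)
qed

text \<open>
  For \<open>\<epsilon> = 0\<close> the matrix \<open>s\<close> is an ultrametric, and minus its quadratic form is at least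
  \<open>\<Sum> m\<^sub>i y\<^sub>i\<^sup>2\<close> on the vectors with coordinate sum \<open>0\<close>, where \<open>m\<^sub>i\<close> is the distance of \<open>i\<close> from its
  nearest neighbour.  The induction merges a point \<open>b\<close> of a closest pair \<open>{a, b}\<close> into \<open>a\<close>.
  The two distances from a third point to \<open>a\<close> and to \<open>b\<close> differ by at most \<open>\<epsilon>\<close> times the minimal
  distance \<open>s a b\<close>, and a defect \<open>e\<close> for \<open>N\<close> points becomes a defect of at most \<open>2 e + \<epsilon> N\<close> for
  \<open>N + 1\<close> points.
\<close>

lemma near_ultrametric_form_neg:
  fixes s :: "nat \<Rightarrow> nat \<Rightarrow> real" and y m :: "nat \<Rightarrow> real"
  assumes "finite W" and "\<epsilon> \<ge> 0"
    and "\<And>i j. i \<in> W \<Longrightarrow> j \<in> W \<Longrightarrow> s i j = s j i"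
    and "\<And>i. i \<in> W \<Longrightarrow> s i i = 0"
    and "\<And>i j. i \<in> W \<Longrightarrow> j \<in> W \<Longrightarrow> s i j \<ge> 0"
    and "\<And>i j k. i \<in> W \<Longrightarrow> j \<in> W \<Longrightarrow> k \<in> W \<Longrightarrow>
           s i j \<le> max (s i k) (s k j) + \<epsilon> * min (s i k) (s k j)"
    and "\<epsilon> * 2 ^ (card W + 1) \<le> 1"
    and "(\<Sum>i\<in>W. y i) = 0"
    and "\<And>i k. i \<in> W \<Longrightarrow> k \<in> W \<Longrightarrow> i \<noteq> k \<Longrightarrow> m i \<le> s i k"
  shows "(\<Sum>i\<in>W. \<Sum>j\<in>W. s i j * y i * y j) \<le>
     - ((1 - \<epsilon> * (2 * 2 ^ card W - real (card W) - 2)) * (\<Sum>i\<in>W. m i * (y i)\<^sup>2))"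
  using assms
proof (induction "card W" arbitrary: W y m)
  case 0
  then show ?case by simp
next
  case (Suc N)
  note eps = \<open>\<epsilon> \<ge> 0\<close> and fin = \<open>finite W\<close>
  note sym = Suc.prems(3) and zero = Suc.prems(4) and nonneg = Suc.prems(5) and tri = Suc.prems(6)
  show ?case
  proof (cases "N = 0")
    case True
    then have "card W = 1" using Suc.hyps(2) by simp
    then obtain a where "W = {a}" by (rule card_1_singletonE)
    then have "y i = 0" if "i \<in> W" for i using Suc.prems(8) that by simp
    then show ?thesis by simp
  next
    case False
    define P where "P = {p \<in> W \<times> W. fst p \<noteq> snd p}"
    have "finite P" using fin by (auto simp: P_def)
    moreover have "P \<noteq> {}"
    proof
      assume "P = {}"
      then have "\<forall>i\<in>W. \<forall>j\<in>W. i = j" by (auto simp: P_def)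
      then have "card W \<le> 1" using card_le_Suc0_iff_eq[OF fin] by simp
      then show False using False Suc.hyps(2) by simp
    qed
    ultimately obtain p where p: "p \<in> P" "\<And>q. q \<in> P \<Longrightarrow> s (fst p) (snd p) \<le> s (fst q) (snd q)"
      using arg_min_if_finite[of P "\<lambda>p. s (fst p) (snd p)"] by (metis not_less)
    define a b where "a = fst p" and "b = snd p"
    have ab: "a \<in> W" "b \<in> W" "a \<noteq> b" and min: "\<And>i j. i \<in> W \<Longrightarrow> j \<in> W \<Longrightarrow> i \<noteq> j \<Longrightarrow> s a b \<le> s i j"
      using p by (auto simp: P_def a_def b_def)
    define X where "X = W - {b}"
    define Y where "Y = W - {a, b}"
    have XY: "X = insert a Y" "a \<notin> Y" "W = insert b X" "b \<notin> X" "finite X" "finite Y" "X \<subseteq> W" "Y \<subseteq> W"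
      using ab fin by (auto simp: X_def Y_def)
    define t where "t = y b"
    define \<sigma> where "\<sigma> = s a b"
    have \<sigma>: "\<sigma> \<ge> 0" using nonneg ab by (simp add: \<sigma>_def)
    \<comment> \<open>The weight \<open>t\<close> of \<open>b\<close> is moved to \<open>a\<close>.\<close>
    define z where "z = y(a := y a + t)"
    \<comment> \<open>The minimal distance \<open>\<sigma>\<close> is also a lower bound, and the induction hypothesis is needed for the larger of the two.\<close>
    define m' where "m' = (\<lambda>i. max (m i) \<sigma>)"
    define e where "e = \<epsilon> * (2 * 2 ^ N - real N - 2)"
    have cardX: "N = card X" using Suc.hyps(2) XY by simp
    have pow: "2 ^ N \<ge> real N + 1"
      by (induction N) auto
    have e: "e \<ge> 0" unfolding e_def using pow eps by (intro mult_nonneg_nonneg) auto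
    have IH: "(\<Sum>i\<in>X. \<Sum>j\<in>X. s i j * z i * z j) \<le> - ((1 - e) * (\<Sum>i\<in>X. m' i * (z i)\<^sup>2))"
      unfolding e_def cardX
    proof (rule Suc.hyps(1)[OF cardX \<open>finite X\<close> eps])
      have "\<epsilon> * 2 ^ (card X + 1) \<le> \<epsilon> * 2 ^ (card W + 1)"
        using eps XY by (intro mult_left_mono) auto
      then show "\<epsilon> * 2 ^ (card X + 1) \<le> 1" using Suc.prems(7) by simp
      have "(\<Sum>i\<in>X. z i) = (\<Sum>i\<in>W. y i)"
        using XY by (simp add: z_def t_def) (intro sum.cong, auto)
      then show "(\<Sum>i\<in>X. z i) = 0" using Suc.prems(8) by simp
      show "m' i \<le> s i k" if "i \<in> X" "k \<in> X" "i \<noteq> k" for i k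
        using Suc.prems(9)[of i k] min[of i k] that XY by (auto simp: m'_def \<sigma>_def)
    qed (use sym zero nonneg tri XY in \<open>auto\<close>)
    have row_b: "(\<Sum>j\<in>X. s b j * y j) = s a b * y a + (\<Sum>j\<in>Y. s b j * y j)"
      using XY ab sym[of a b] by simp
    define R where "R = (\<Sum>j\<in>Y. (s b j - s a j) * y j)"
    have expand: "(\<Sum>i\<in>W. \<Sum>j\<in>W. s i j * y i * y j)
        = (\<Sum>i\<in>X. \<Sum>j\<in>X. s i j * z i * z j) + 2 * t * \<sigma> * y a + 2 * t * R"
    proof -
      have zY: "z j = y j" if "j \<in> Y" for j using that XY by (auto simp: z_def)
      have "(\<Sum>i\<in>W. \<Sum>j\<in>W. s i j * y i * y j) =
          2 * t * (\<Sum>j\<in>X. s b j * y j) + (\<Sum>i\<in>X. \<Sum>j\<in>X. s i j * y i * y j)"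
        unfolding \<open>W = insert b X\<close>
        by (subst quadratic_sum_insert) (use XY ab zero[of b] sym in \<open>auto simp: t_def\<close>)
      moreover have "(\<Sum>i\<in>X. \<Sum>j\<in>X. s i j * g i * g j) =
          2 * g a * (\<Sum>j\<in>Y. s a j * g j) + (\<Sum>i\<in>Y. \<Sum>j\<in>Y. s i j * g i * g j)" for g
        unfolding \<open>X = insert a Y\<close>
        by (subst quadratic_sum_insert) (use XY ab zero[of a] sym in auto)
      moreover have "z a = y a + t" by (simp add: z_def)
      ultimately have W: "(\<Sum>i\<in>W. \<Sum>j\<in>W. s i j * y i * y j) =
          2 * t * (\<sigma> * y a + (\<Sum>j\<in>Y. s b j * y j)) + 2 * y a * (\<Sum>j\<in>Y. s a j * y j) +
          (\<Sum>i\<in>Y. \<Sum>j\<in>Y. s i j * y i * y j)"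
        and X: "(\<Sum>i\<in>X. \<Sum>j\<in>X. s i j * z i * z j) =
          2 * (y a + t) * (\<Sum>j\<in>Y. s a j * y j) + (\<Sum>i\<in>Y. \<Sum>j\<in>Y. s i j * y i * y j)"
        using row_b zY by (simp_all add: \<sigma>_def)
      show ?thesis unfolding W X R_def
        by (simp add: left_diff_distrib sum_subtractf algebra_simps)
    qed
    define S where "S = (\<Sum>j\<in>Y. m' j * (y j)\<^sup>2)"
    have S: "\<sigma> * (\<Sum>j\<in>Y. (y j)\<^sup>2) \<le> S" "0 \<le> S"
      unfolding S_def sum_distrib_left using \<sigma>
      by (auto intro!: sum_mono mult_right_mono sum_nonneg mult_nonneg_nonneg simp: m'_def)
    have err: "2 * t * R \<le> \<epsilon> * (N * (\<sigma> * t\<^sup>2) + S)"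
    proof -
      have "2 * t * R = (\<Sum>j\<in>Y. 2 * t * ((s b j - s a j) * y j))"
        unfolding R_def by (simp add: sum_distrib_left)
      also have "\<dots> \<le> (\<Sum>j\<in>Y. \<epsilon> * \<sigma> * (t\<^sup>2 + (y j)\<^sup>2))"
      proof (rule sum_mono)
        fix j assume "j \<in> Y"
        then have j: "j \<in> W" "j \<noteq> a" "j \<noteq> b" by (auto simp: Y_def)
        have "\<bar>s b j - s a j\<bar> \<le> \<epsilon> * \<sigma>"
          using tri[of b j a] tri[of a j b] min[of a j] min[of b j] j ab sym[of a b]
          by (auto simp: \<sigma>_def max_def min_def split: if_splits)
        moreover have "2 * \<bar>t\<bar> * \<bar>y j\<bar> \<le> t\<^sup>2 + (y j)\<^sup>2"
          using sum_squares_bound[of "\<bar>t\<bar>" "\<bar>y j\<bar>"] by simp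
        ultimately have "\<bar>s b j - s a j\<bar> * (2 * \<bar>t\<bar> * \<bar>y j\<bar>) \<le> \<epsilon> * \<sigma> * (t\<^sup>2 + (y j)\<^sup>2)"
          using eps \<sigma> by (intro mult_mono) auto
        moreover have "2 * t * ((s b j - s a j) * y j) \<le> \<bar>s b j - s a j\<bar> * (2 * \<bar>t\<bar> * \<bar>y j\<bar>)"
        proof -
          have "2 * t * (D * y j) \<le> \<bar>D\<bar> * (2 * \<bar>t\<bar> * \<bar>y j\<bar>)" for D
            using abs_ge_self[of "2 * t * (D * y j)"] by (simp add: abs_mult mult_ac)
          then show ?thesis .
        qed
        ultimately show "2 * t * ((s b j - s a j) * y j) \<le> \<epsilon> * \<sigma> * (t\<^sup>2 + (y j)\<^sup>2)"
          by linarith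
      qed
      also have "\<dots> = \<epsilon> * (card Y * (\<sigma> * t\<^sup>2) + \<sigma> * (\<Sum>j\<in>Y. (y j)\<^sup>2))"
        by (simp add: sum.distrib algebra_simps sum_distrib_left)
      also have "\<dots> \<le> \<epsilon> * (N * (\<sigma> * t\<^sup>2) + S)"
        using cardX XY \<sigma> S eps by (intro mult_left_mono add_mono mult_right_mono) auto
      finally show ?thesis .
    qed
    define G where "G = S + \<sigma> * (y a)\<^sup>2 + \<sigma> * t\<^sup>2"
    have sumX: "(\<Sum>i\<in>X. m' i * (z i)\<^sup>2) = S + m' a * (y a + t)\<^sup>2"
    proof -
      have "(\<Sum>i\<in>Y. m' i * (z i)\<^sup>2) = S"
        unfolding S_def using XY by (intro sum.cong) (auto simp: z_def)
      then show ?thesis using XY by (simp add: z_def)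
    qed
    have m'a: "m' a = \<sigma>" using Suc.prems(9)[of a b] ab by (simp add: m'_def \<sigma>_def)
    have m'b: "m' b = \<sigma>" using Suc.prems(9)[of b a] ab sym[of a b] by (simp add: m'_def \<sigma>_def)
    have "(\<Sum>i\<in>W. \<Sum>j\<in>W. s i j * y i * y j)
        \<le> - (S + \<sigma> * (y a + t)\<^sup>2) + e * (S + \<sigma> * (y a + t)\<^sup>2) + 2 * t * \<sigma> * y a + 2 * t * R"
      using IH unfolding expand sumX m'a by (simp add: algebra_simps)
    also have "\<dots> = - G + e * (S + \<sigma> * (y a + t)\<^sup>2) + 2 * t * R"
      by (simp add: G_def power2_eq_square algebra_simps)
    also have "\<dots> \<le> - G + 2 * e * G + \<epsilon> * N * G"
    proof -
      have "(y a + t)\<^sup>2 \<le> 2 * (y a)\<^sup>2 + 2 * t\<^sup>2"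
        using sum_squares_bound[of "y a" t] by (simp add: power2_sum)
      then have "\<sigma> * (y a + t)\<^sup>2 \<le> \<sigma> * (2 * (y a)\<^sup>2 + 2 * t\<^sup>2)"
        using \<sigma> by (rule mult_left_mono)
      then have "S + \<sigma> * (y a + t)\<^sup>2 \<le> 2 * G"
        using S(2) by (simp add: G_def algebra_simps)
      then have "e * (S + \<sigma> * (y a + t)\<^sup>2) \<le> 2 * e * G"
        using mult_left_mono[OF _ e] by fastforce
      moreover have "N * (\<sigma> * t\<^sup>2) + S \<le> N * G"
      proof -
        have "1 * (S + \<sigma> * (y a)\<^sup>2) \<le> N * (S + \<sigma> * (y a)\<^sup>2)"
          using False S(2) \<sigma> by (intro mult_right_mono) auto
        moreover have "0 \<le> \<sigma> * (y a)\<^sup>2" using \<sigma> by simp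
        ultimately show ?thesis unfolding G_def distrib_left by linarith
      qed
      then have "2 * t * R \<le> \<epsilon> * N * G"
        using err mult_left_mono[OF _ eps] by (fastforce simp: mult.assoc)
      ultimately show ?thesis by linarith
    qed
    also have "\<dots> = - ((1 - (2 * e + \<epsilon> * N)) * G)" by (simp add: algebra_simps)
    finally have main: "(\<Sum>i\<in>W. \<Sum>j\<in>W. s i j * y i * y j) \<le> - ((1 - (2 * e + \<epsilon> * N)) * G)" .
    define e' where "e' = \<epsilon> * (2 * 2 ^ card W - real (card W) - 2)"
    have e'_ge: "2 * e + \<epsilon> * N \<le> e'"
      using eps unfolding e_def e'_def Suc.hyps(2)[symmetric] by (simp add: algebra_simps)
    have "e' \<le> \<epsilon> * 2 ^ (card W + 1)"
      unfolding e'_def using eps by (intro mult_left_mono) auto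
    then have e'_le: "e' \<le> 1" using Suc.prems(7) by linarith
    have "0 \<le> G" using S(2) \<sigma> by (simp add: G_def)
    have "(\<Sum>i\<in>W. m i * (y i)\<^sup>2) \<le> (\<Sum>i\<in>W. m' i * (y i)\<^sup>2)"
      by (intro sum_mono mult_right_mono) (auto simp: m'_def)
    also have "\<dots> = G"
      unfolding G_def S_def using XY ab m'a m'b by (simp add: t_def)
    finally have mG: "(\<Sum>i\<in>W. m i * (y i)\<^sup>2) \<le> G" .
    have "(1 - e') * (\<Sum>i\<in>W. m i * (y i)\<^sup>2) \<le> (1 - e') * G"
      using mG e'_le by (intro mult_left_mono) auto
    also have "\<dots> \<le> (1 - (2 * e + \<epsilon> * N)) * G"
      using e'_ge \<open>0 \<le> G\<close> by (intro mult_right_mono) auto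
    finally show ?thesis using main unfolding e'_def[symmetric] by linarith
  qed
qed

text \<open>
  The hyperplane on which the form is nonpositive is the orthogonal complement of a nonzero row
  \<open>R r\<close>.  If \<open>R i r = 0\<close>, then the relations force row \<open>i\<close> to be proportional to row \<open>r\<close> on the
  indices \<open>k\<close> with \<open>R r k > 0\<close> and to vanish elsewhere, so these indices do not contribute on the
  hyperplane.
\<close>

lemma reverse_CS_if_four_point:
  fixes R :: "nat \<Rightarrow> nat \<Rightarrow> real"
  assumes sym: "\<And>i j. i < n \<Longrightarrow> j < n \<Longrightarrow> R i j = R j i"
    and nonneg: "\<And>i j. i < n \<Longrightarrow> j < n \<Longrightarrow> R i j \<ge> 0"
    and rel: "\<And>i j k l. i < n \<Longrightarrow> j < n \<Longrightarrow> k < n \<Longrightarrow> l < n \<Longrightarrow>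
       R i j * R k l \<le> max (R i k * R j l) (R i l * R j k) + \<epsilon> * min (R i k * R j l) (R i l * R j k)"
    and eps: "0 \<le> \<epsilon>" "\<epsilon> * (D * 2 ^ (n + 4)) \<le> 1" and D: "D \<ge> 1"
    and \<theta>: "\<And>i. i < n \<Longrightarrow> \<theta> i \<le> 1 - 1 / D"
  shows "reverse_CS n (\<lambda>i j. if i = j then \<theta> i * R i i else R i j)"
proof -
  define M where "M = (\<lambda>i j. if i = j then \<theta> i * R i i else R i j)"
  have M_sym: "symmetric_on n M" using sym by (simp add: M_def symmetric_on_def)
  have "\<exists>h. \<forall>x. ip n h x = 0 \<longrightarrow> bform n M x x \<le> 0"
  proof (cases "\<exists>r<n. \<exists>k<n. R r k > 0")
    case False
    then have "R i j = 0" if "i < n" "j < n" for i j using nonneg[OF that] that by force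
    then have "bform n M x x = 0" for x by (auto simp: bform_def M_def intro!: sum.neutral)
    then show ?thesis by simp
  next
    case True
    then obtain r k0 where r: "r < n" "k0 < n" "R r k0 > 0" by blast
    define W where "W = {i. i < n \<and> R r i > 0}"
    define Z where "Z = {i. i < n \<and> R r i = 0}"
    have WZ: "{..<n} = W \<union> Z" "W \<inter> Z = {}" "finite W" "finite Z"
      using nonneg[OF r(1)] by (force simp: W_def Z_def)+
    have W: "i < n" "R r i > 0" "R i r > 0" if "i \<in> W" for i using that sym[OF r(1)] by (auto simp: W_def)
    have Z: "i < n" "R r i = 0" "R i r = 0" if "i \<in> Z" for i using that sym[OF _ r(1), of i] by (auto simp: Z_def)
    have ZZ: "R i j = 0" if "i \<in> Z" "j \<in> Z" for i j
    proof -
      have "R i j * R r k0 \<le> 0"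
        using rel[OF Z(1)[OF that(1)] Z(1)[OF that(2)] r(1,2)] Z(3)[OF that(1)] Z(3)[OF that(2)] by simp
      then have "R i j \<le> 0" using r by (simp add: mult_le_0_iff)
      then show ?thesis using nonneg[OF Z(1)[OF that(1)] Z(1)[OF that(2)]] by simp
    qed
    have ZW: "R i k * R r l = R i l * R r k" if "i \<in> Z" "k \<in> W" "l \<in> W" for i k l
    proof -
      have "R i k * R r l \<le> R i l * R r k" if "k \<in> W" "l \<in> W" for k l
        using rel[OF Z(1)[OF \<open>i \<in> Z\<close>] W(1)[OF that(1)] W(1)[OF that(2)] r(1)]
          Z(3)[OF \<open>i \<in> Z\<close>] nonneg[OF Z(1)[OF \<open>i \<in> Z\<close>] W(1)[OF that(2)]] W(3)[OF that(1)]
          sym[OF r(1) W(1)[OF that(1)]] sym[OF r(1) W(1)[OF that(2)]]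
        by simp
      then show ?thesis using that by (meson order_antisym)
    qed
    have "bform n M x x \<le> 0" if hx: "ip n (R r) x = 0" for x
    proof -
      have hW: "(\<Sum>k\<in>W. R r k * x k) = 0"
        using hx WZ Z(2) unfolding ip_def WZ(1) by (subst (asm) sum.union_disjoint) auto
      have rowZ: "(\<Sum>k\<in>W. R i k * x k) = 0" if "i \<in> Z" for i
      proof (cases "W = {}")
        case False
        then obtain l where l: "l \<in> W" by blast
        have "R r l * (\<Sum>k\<in>W. R i k * x k) = R i l * (\<Sum>k\<in>W. R r k * x k)"
          unfolding sum_distrib_left
        proof (intro sum.cong refl)
          fix k assume "k \<in> W"
          have "R r l * R i k = R i l * R r k"
            using ZW[OF that \<open>k \<in> W\<close> l] by (simp only: mult.commute)
          then show "R r l * (R i k * x k) = R i l * (R r k * x k)"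
            by (simp only: mult.assoc[symmetric])
        qed
        then show ?thesis using hW W(2)[OF l] by simp
      qed simp
      have ZWsum: "(\<Sum>i\<in>Z. \<Sum>k\<in>W. M i k * x i * x k) = 0"
      proof (rule sum.neutral, rule ballI)
        fix i assume i: "i \<in> Z"
        have "(\<Sum>k\<in>W. M i k * x i * x k) = x i * (\<Sum>k\<in>W. R i k * x k)"
          unfolding sum_distrib_left using WZ(2) i by (intro sum.cong refl) (auto simp: M_def)
        then show "(\<Sum>k\<in>W. M i k * x i * x k) = 0" using rowZ[OF i] by simp
      qed
      have WZsum: "(\<Sum>i\<in>W. \<Sum>k\<in>Z. M i k * x i * x k) = 0"
      proof -
        have "(\<Sum>i\<in>W. \<Sum>k\<in>Z. M i k * x i * x k) = (\<Sum>k\<in>Z. \<Sum>i\<in>W. M k i * x k * x i)"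
          using M_sym W(1) Z(1) by (subst sum.swap) (auto intro!: sum.cong simp: symmetric_on_def)
        then show ?thesis using ZWsum by simp
      qed
      have ZZsum: "(\<Sum>i\<in>Z. \<Sum>k\<in>Z. M i k * x i * x k) = 0"
        using ZZ by (auto simp: M_def intro!: sum.neutral)
      have "bform n M x x = (\<Sum>i\<in>W. \<Sum>j\<in>W. M i j * x i * x j)"
        unfolding bform_def WZ(1) using WZ(2-4) ZWsum WZsum ZZsum
        by (simp add: sum.union_disjoint sum.distrib)
      define y where "y = (\<lambda>i. R r i * x i)"
      define S where "S = (\<lambda>i j. R i j / (R r i * R r j))"
      define s where "s = (\<lambda>i j. if i = j then 0 else S i j)"
      have S_nonneg: "S i j \<ge> 0" if "i \<in> W" "j \<in> W" for i j
        using nonneg[OF W(1)[OF that(1)] W(1)[OF that(2)]] W(2)[OF that(1)] W(2)[OF that(2)] by (simp add: S_def)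
      have S_sym: "S i j = S j i" if "i \<in> W" "j \<in> W" for i j
        using sym W(1) that by (simp add: S_def mult.commute)
      have S_tri: "S i j \<le> max (S i k) (S k j) + \<epsilon> * min (S i k) (S k j)"
        if ijk: "i \<in> W" "j \<in> W" "k \<in> W" for i j k
      proof -
        define c where "c = R r i * R r j * R r k"
        have c: "c > 0" using W(2) ijk by (simp add: c_def)
        have e: "c * S i j = R i j * R k r" "c * S i k = R i k * R j r" "c * S k j = R i r * R j k"
          using W(2)[OF ijk(1)] W(2)[OF ijk(2)] W(2)[OF ijk(3)] sym[OF W(1)[OF ijk(1)] r(1)]
            sym[OF W(1)[OF ijk(2)] r(1)] sym[OF W(1)[OF ijk(3)] r(1)]
            sym[OF W(1)[OF ijk(2)] W(1)[OF ijk(3)]]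
          by (simp_all add: c_def S_def)
        have "c * S i j \<le> max (c * S i k) (c * S k j) + \<epsilon> * min (c * S i k) (c * S k j)"
          unfolding e using ijk by (intro rel W(1) r(1))
        also have "\<dots> = c * (max (S i k) (S k j) + \<epsilon> * min (S i k) (S k j))"
          using c by (simp add: max_mult_distrib_left min_mult_distrib_left distrib_left mult.left_commute)
        finally show ?thesis using c by simp
      qed
      define e where "e = \<epsilon> * (2 * 2 ^ card W - real (card W) - 2)"
      have "card W \<le> card {..<n}" using WZ by (intro card_mono) auto
      then have "card W \<le> n" by simp
      then have pow: "2 * 2 ^ card W \<le> 2 * (2::real) ^ n" by (simp add: power_increasing)
      then have e: "e \<le> \<epsilon> * (2 * 2 ^ n)" "\<epsilon> * (2 * 2 ^ card W) \<le> \<epsilon> * (2 * 2 ^ n)"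
        unfolding e_def using eps(1) pow by (intro mult_left_mono; linarith)+
      have "\<epsilon> * (2 * 2 ^ n + 1) \<le> 1 / D"
      proof -
        have "(2::real) * 2 ^ n + 1 \<le> 2 ^ (n + 4)"
        proof -
          have "(2::real) ^ (n + 4) = 16 * 2 ^ n" by (simp add: power_add)
          moreover have "1 \<le> (2::real) ^ n" by (rule one_le_power) simp
          ultimately show ?thesis by linarith
        qed
        then have "\<epsilon> * (2 * 2 ^ n + 1) \<le> \<epsilon> * 2 ^ (n + 4)" using eps(1) by (rule mult_left_mono)
        also have "\<dots> \<le> 1 / D" using eps(2) D by (simp add: field_simps)
        finally show ?thesis .
      qed
      then have small: "\<epsilon> * (2 * 2 ^ n) + \<epsilon> \<le> 1 / D" by (simp add: algebra_simps)
      have "1 / D \<le> 1" using D by simp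
      have core: "(\<Sum>i\<in>W. \<Sum>j\<in>W. s i j * y i * y j) \<le> - ((1 - e) * (\<Sum>i\<in>W. S i i / (1 + \<epsilon>) * (y i)\<^sup>2))"
        unfolding e_def
      proof (rule near_ultrametric_form_neg[OF \<open>finite W\<close> eps(1)])
        show "\<epsilon> * 2 ^ (card W + 1) \<le> 1" using e(2) small \<open>1 / D \<le> 1\<close> eps(1) by simp
        show "sum y W = 0" using hW by (simp add: y_def)
        show "S i i / (1 + \<epsilon>) \<le> s i k" if "i \<in> W" "k \<in> W" "i \<noteq> k" for i k
          using S_tri[OF that(1,1,2)] S_sym[OF that(1,2)] that(3) eps(1)
          by (simp add: s_def pos_divide_le_eq algebra_simps)
        show "s i j \<le> max (s i k) (s k j) + \<epsilon> * min (s i k) (s k j)"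
          if "i \<in> W" "j \<in> W" "k \<in> W" for i j k
        proof (cases "i = j \<or> i = k \<or> k = j")
          case True
          then show ?thesis
            using S_nonneg[OF that(1,2)] S_nonneg[OF that(1,3)] S_nonneg[OF that(3,2)] eps(1)
            by (auto simp: s_def max_absorb1 max_absorb2 min_absorb1 min_absorb2)
        qed (use S_tri[OF that] in \<open>simp add: s_def\<close>)
      qed (use S_sym S_nonneg in \<open>auto simp: s_def\<close>)
      have "(\<Sum>i\<in>W. \<Sum>j\<in>W. M i j * x i * x j) =
          (\<Sum>i\<in>W. \<Sum>j\<in>W. s i j * y i * y j + (if i = j then \<theta> i * S i i * (y i)\<^sup>2 else 0))"
        using W(2) by (intro sum.cong refl)
          (auto simp: M_def s_def S_def y_def power2_eq_square dest: W(2))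
      also have "\<dots> = (\<Sum>i\<in>W. \<Sum>j\<in>W. s i j * y i * y j) + (\<Sum>i\<in>W. \<theta> i * S i i * (y i)\<^sup>2)"
        using WZ(3) by (simp add: sum.distrib)
      also have "\<dots> \<le> - (\<Sum>i\<in>W. (1 - e) * (S i i / (1 + \<epsilon>) * (y i)\<^sup>2)) + (\<Sum>i\<in>W. \<theta> i * S i i * (y i)\<^sup>2)"
        using core by (simp add: sum_distrib_left)
      also have "\<dots> \<le> 0"
      proof -
        have "(\<Sum>i\<in>W. \<theta> i * S i i * (y i)\<^sup>2) \<le> (\<Sum>i\<in>W. (1 - e) * (S i i / (1 + \<epsilon>) * (y i)\<^sup>2))"
        proof (rule sum_mono)
          fix i assume i: "i \<in> W"
          have "\<theta> i * (1 + \<epsilon>) \<le> (1 - 1 / D) * (1 + \<epsilon>)"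
            using \<theta>[OF W(1)[OF i]] eps by (intro mult_right_mono) auto
          also have "\<dots> = 1 + \<epsilon> - 1 / D - \<epsilon> / D" by (simp add: algebra_simps add_divide_distrib)
          also have "\<dots> \<le> 1 - e"
          proof -
            have "\<epsilon> / D \<ge> 0" using eps D by simp
            then show ?thesis using small e(1) by linarith
          qed
          finally have "\<theta> i \<le> (1 - e) / (1 + \<epsilon>)" using eps by (simp add: pos_le_divide_eq)
          then have "\<theta> i * (S i i * (y i)\<^sup>2) \<le> (1 - e) / (1 + \<epsilon>) * (S i i * (y i)\<^sup>2)"
            using S_nonneg[OF i i] by (intro mult_right_mono) auto
          then show "\<theta> i * S i i * (y i)\<^sup>2 \<le> (1 - e) * (S i i / (1 + \<epsilon>) * (y i)\<^sup>2)"
            by (simp add: mult.assoc)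
        qed
        then show ?thesis by simp
      qed
      finally show ?thesis using \<open>bform n M x x = _\<close> by simp
    qed
    then show ?thesis by blast
  qed
  then show ?thesis
    unfolding M_def[symmetric] using reverse_CS_if_nonpos_on_hyperplane[OF M_sym] by blast
qed

section \<open>Exponent vectors and directional derivatives\<close>

text \<open>
  Unit vectors are defined with the numeral \<open>1\<close> and have to stay in this form.
\<close>

declare One_nat_def [simp del]

lemma expo_fact_superset:
  assumes "finite S" "Poly_Mapping.keys \<alpha> \<subseteq> S"
  shows "expo_fact \<alpha> = (\<Prod>i\<in>S. fact (expo_at \<alpha> i))"
  unfolding expo_fact_def using assms by (intro prod.mono_neutral_left) (auto simp: in_keys_iff)

lemma expo_fact_pos: "expo_fact \<alpha> > 0"
  unfolding expo_fact_def by (intro prod_pos) auto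

lemma expo_fact_zero [simp]: "expo_fact 0 = 1"
  by (simp add: expo_fact_def)

lemma expo_fact_add_unit: "expo_fact (\<alpha> + unit_expo i) = real (expo_at \<alpha> i + 1) * expo_fact \<alpha>"
proof -
  let ?S = "insert i (Poly_Mapping.keys \<alpha>)"
  have "Poly_Mapping.keys (\<alpha> + unit_expo i) \<subseteq> ?S" using Poly_Mapping.keys_add[of \<alpha> "unit_expo i"] by auto
  then have "expo_fact (\<alpha> + unit_expo i) = (\<Prod>k\<in>?S. fact (expo_at (\<alpha> + unit_expo i) k))"
    by (intro expo_fact_superset) auto
  also have "\<dots> = (\<Prod>k\<in>?S. (if k = i then real (expo_at \<alpha> i + 1) else 1) * fact (expo_at \<alpha> k))"
    by (intro prod.cong refl) (auto simp: lookup_add lookup_single One_nat_def)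
  also have "\<dots> = real (expo_at \<alpha> i + 1) * (\<Prod>k\<in>?S. fact (expo_at \<alpha> k))"
    by (simp only: prod.distrib) simp
  also have "(\<Prod>k\<in>?S. fact (expo_at \<alpha> k)) = expo_fact \<alpha>"
    by (rule expo_fact_superset[symmetric]) auto
  finally show ?thesis .
qed

text \<open>
  The normalized coefficient \<open>\<alpha>! f\<^sub>\<alpha>\<close>, which is the value at \<open>0\<close> of \<open>\<partial>\<^sup>\<alpha> f\<close>.  A partial derivative
  merely shifts the normalized coefficients.
\<close>

definition ncoef :: "rpoly \<Rightarrow> expo \<Rightarrow> real" where
  "ncoef f \<alpha> = expo_fact \<alpha> * coef f \<alpha>"

lemma ncoef_mpderiv: "ncoef (mpderiv i f) \<alpha> = ncoef f (\<alpha> + unit_expo i)"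
  by (simp add: ncoef_def coef_mpderiv expo_fact_add_unit)

lemma ncoef_mpderiv_funpow:
  "ncoef ((mpderiv i ^^ k) f) \<alpha> = ncoef f (\<alpha> + Poly_Mapping.single i k)"
proof (induction k arbitrary: \<alpha>)
  case (Suc k)
  have "unit_expo i + Poly_Mapping.single i k = Poly_Mapping.single i (Suc k)"
    by (simp add: One_nat_def flip: single_add)
  then show ?case by (simp add: ncoef_mpderiv Suc.IH add.assoc)
qed simp

lemma sum_single_expo:
  assumes "Poly_Mapping.keys \<alpha> \<subseteq> {..<n}"
  shows "(\<Sum>i<n. Poly_Mapping.single i (expo_at \<alpha> i)) = \<alpha>"
proof (rule poly_mapping_eqI)
  fix k
  have "expo_at (\<Sum>i<n. Poly_Mapping.single i (expo_at \<alpha> i)) k = (\<Sum>i<n. if i = k then expo_at \<alpha> k else 0)"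
    by (auto simp: lookup_sum lookup_single when_def intro: sum.cong)
  also have "\<dots> = expo_at \<alpha> k" using assms by (auto simp: in_keys_iff)
  finally show "expo_at (\<Sum>i<n. Poly_Mapping.single i (expo_at \<alpha> i)) k = expo_at \<alpha> k" .
qed

lemma ncoef_multi_mpderiv:
  assumes "Poly_Mapping.keys \<alpha> \<subseteq> {..<n}"
  shows "ncoef (multi_mpderiv n \<alpha> f) \<gamma> = ncoef f (\<gamma> + \<alpha>)"
proof -
  have "ncoef (fold (\<lambda>i. mpderiv i ^^ expo_at \<alpha> i) [0..<m] f) \<gamma> =
      ncoef f (\<gamma> + (\<Sum>i<m. Poly_Mapping.single i (expo_at \<alpha> i)))" for m
    by (induction m arbitrary: \<gamma>) (simp_all add: ncoef_mpderiv_funpow add_ac)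
  then show ?thesis by (simp add: multi_mpderiv_def sum_single_expo[OF assms])
qed

lemma quadratic_hessian_eq:
  assumes "Poly_Mapping.keys \<alpha> \<subseteq> {..<n}"
  shows "quadratic_hessian n (multi_mpderiv n \<alpha> f) =
    Matrix.mat n n (\<lambda>(i, j). ncoef f (\<alpha> + unit_expo i + unit_expo j))"
proof -
  have "coef (mpderiv i (mpderiv j (multi_mpderiv n \<alpha> f))) 0 = ncoef f (\<alpha> + unit_expo i + unit_expo j)" for i j
    using ncoef_mpderiv[of i "mpderiv j (multi_mpderiv n \<alpha> f)" 0]
    by (simp add: ncoef_mpderiv ncoef_multi_mpderiv[OF assms] ncoef_def[of _ 0] add_ac)
  then show ?thesis unfolding quadratic_hessian_def by simp
qed

lemma Delta_keys: "\<alpha> \<in> Delta n d \<Longrightarrow> Poly_Mapping.keys \<alpha> \<subseteq> {..<n}"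
  by (simp add: Delta_def)

lemma Delta_0: "\<alpha> \<in> Delta n 0 \<longleftrightarrow> \<alpha> = 0"
proof
  assume "\<alpha> \<in> Delta n 0"
  then show "\<alpha> = 0" using sum_single_expo[of \<alpha> n] by (auto simp: Delta_def)
qed (simp add: Delta_def)

lemma keys_add_unit: "Poly_Mapping.keys (\<alpha> + unit_expo i) = insert i (Poly_Mapping.keys (\<alpha>::expo))"
  by (auto simp: in_keys_iff lookup_add lookup_single when_def split: if_splits)

lemma Delta_add_unit:
  assumes "i < n"
  shows "\<alpha> + unit_expo i \<in> Delta n (Suc d) \<longleftrightarrow> \<alpha> \<in> Delta n d"
proof -
  have "(\<Sum>k<n. expo_at (\<alpha> + unit_expo i) k) = Suc (\<Sum>k<n. expo_at \<alpha> k)"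
    using assms by (simp add: lookup_add lookup_single when_def sum.distrib)
  then show ?thesis using assms by (simp add: Delta_def keys_add_unit)
qed

lemma Delta_add_two_units:
  assumes "d \<ge> 2" "\<alpha> \<in> Delta n (d - 2)" "a < n" "b < n"
  shows "\<alpha> + unit_expo a + unit_expo b \<in> Delta n d"
proof -
  have "\<alpha> + unit_expo a + unit_expo b \<in> Delta n (Suc (Suc (d - 2)))"
    using assms by (simp add: Delta_add_unit)
  moreover have "Suc (Suc (d - 2)) = d" using assms(1) by simp
  ultimately show ?thesis by simp
qed

lemma expo_minus_unit: "expo_at \<alpha> i > 0 \<Longrightarrow> \<alpha> - unit_expo i + unit_expo i = \<alpha>"
  by (auto intro!: poly_mapping_eqI simp: lookup_add lookup_minus lookup_single when_def)

lemma Delta_Suc_obtain: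
  assumes "\<beta> \<in> Delta n (Suc d)"
  obtains i \<beta>' where "i < n" "\<beta>' \<in> Delta n d" "\<beta> = \<beta>' + unit_expo i"
proof -
  have "(\<Sum>i<n. expo_at \<beta> i) \<noteq> 0" using assms by (simp add: Delta_def)
  then obtain i where i: "i < n" "expo_at \<beta> i > 0" by (auto simp: neq0_conv)
  then have "\<beta> - unit_expo i \<in> Delta n d"
    using Delta_add_unit[OF i(1), of "\<beta> - unit_expo i" d] expo_minus_unit[of \<beta> i] assms by simp
  then show ?thesis using that[OF i(1)] expo_minus_unit[OF i(2)] by metis
qed

lemma finite_Delta: "finite (Delta n d)"
proof (induction d)
  case 0
  have "Delta n 0 = {0}" by (auto simp: Delta_0)
  then show ?case by simp
next
  case (Suc d)
  have "Delta n (Suc d) \<subseteq> (\<lambda>(i, \<beta>). \<beta> + unit_expo i) ` ({..<n} \<times> Delta n d)"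
  proof
    fix \<beta> assume "\<beta> \<in> Delta n (Suc d)"
    then obtain i \<beta>' where "i < n" "\<beta>' \<in> Delta n d" "\<beta> = \<beta>' + unit_expo i" by (rule Delta_Suc_obtain)
    then show "\<beta> \<in> (\<lambda>(i, \<beta>). \<beta> + unit_expo i) ` ({..<n} \<times> Delta n d)" by force
  qed
  then show ?case using Suc.IH finite_subset by blast
qed

lemma expo_at_le_Delta: "\<alpha> \<in> Delta n d \<Longrightarrow> i < n \<Longrightarrow> expo_at \<alpha> i \<le> d"
  unfolding Delta_def using member_le_sum[of i "{..<n}" "expo_at \<alpha>"] by auto

text \<open>
  The derivative in the direction \<open>v\<close>, as an operator on normalized coefficients.
\<close>

definition dderiv :: "nat \<Rightarrow> (nat \<Rightarrow> real) \<Rightarrow> (expo \<Rightarrow> real) \<Rightarrow> expo \<Rightarrow> real" where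
  "dderiv n v c = (\<lambda>\<gamma>. \<Sum>i<n. v i * c (\<gamma> + unit_expo i))"

text \<open>
  The iterated derivative in the directions listed in \<open>vs\<close>; their order is irrelevant.
\<close>

definition dderivs :: "nat \<Rightarrow> (nat \<Rightarrow> real) list \<Rightarrow> (expo \<Rightarrow> real) \<Rightarrow> expo \<Rightarrow> real" where
  "dderivs n vs c = foldr (dderiv n) vs c"

lemma dderivs_simps [simp]:
  "dderivs n [] c = c" "dderivs n (v # vs) c = dderiv n v (dderivs n vs c)"
  by (simp_all add: dderivs_def)

lemma dderiv_commute: "dderiv n v (dderiv n w c) = dderiv n w (dderiv n v c)"
proof
  fix \<gamma>
  have "dderiv n v (dderiv n w c) \<gamma> = (\<Sum>i<n. \<Sum>j<n. v i * w j * c (\<gamma> + unit_expo i + unit_expo j))"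
    by (simp add: dderiv_def sum_distrib_left mult.assoc)
  also have "\<dots> = (\<Sum>j<n. \<Sum>i<n. v i * w j * c (\<gamma> + unit_expo i + unit_expo j))"
    by (rule sum.swap)
  also have "\<dots> = dderiv n w (dderiv n v c) \<gamma>"
    by (simp add: dderiv_def sum_distrib_left mult_ac add_ac)
  finally show "dderiv n v (dderiv n w c) \<gamma> = dderiv n w (dderiv n v c) \<gamma>" .
qed

lemma dderivs_cong_mset:
  assumes "mset vs = mset ws"
  shows "dderivs n vs c = dderivs n ws c"
proof -
  have "fold (dderiv n) (rev vs) = fold (dderiv n) (rev ws)"
    by (rule fold_multiset_equiv) (use assms in \<open>auto simp: fun_eq_iff dderiv_commute\<close>)
  then show ?thesis by (simp add: dderivs_def foldr_conv_fold)
qed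

lemma dderivs_nonneg:
  assumes "\<And>\<gamma>. c \<gamma> \<ge> 0" and "\<And>v i. v \<in> set vs \<Longrightarrow> i < n \<Longrightarrow> v i > 0"
  shows "dderivs n vs c \<gamma> \<ge> 0"
  using assms(2)
proof (induction vs arbitrary: \<gamma>)
  case (Cons v vs)
  then show ?case by (auto simp: dderiv_def less_imp_le intro!: sum_nonneg mult_nonneg_nonneg)
qed (use assms(1) in simp)

lemma dderivs_pos_iff:
  assumes c: "\<And>\<gamma>. c \<gamma> \<ge> 0" and "\<And>v i. v \<in> set vs \<Longrightarrow> i < n \<Longrightarrow> v i > 0"
  shows "dderivs n vs c \<gamma> > 0 \<longleftrightarrow> (\<exists>\<beta>\<in>Delta n (length vs). c (\<gamma> + \<beta>) > 0)"
  using assms(2)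
proof (induction vs arbitrary: \<gamma>)
  case Nil
  then show ?case by (simp add: Delta_0)
next
  case (Cons v vs)
  have nn: "dderivs n vs c \<delta> \<ge> 0" for \<delta> using dderivs_nonneg[OF c] Cons.prems by simp
  have IH: "dderivs n vs c \<delta> > 0 \<longleftrightarrow> (\<exists>\<beta>\<in>Delta n (length vs). c (\<delta> + \<beta>) > 0)" for \<delta>
    using Cons by simp
  have v: "v i > 0" if "i < n" for i using Cons.prems that by simp
  have terms: "v i * dderivs n vs c (\<gamma> + unit_expo i) \<ge> 0" if "i < n" for i
    using nn v[OF that] by (simp add: less_imp_le)
  have "dderivs n (v # vs) c \<gamma> > 0 \<longleftrightarrow> (\<exists>i<n. dderivs n vs c (\<gamma> + unit_expo i) > 0)"
  proof
    assume pos: "dderivs n (v # vs) c \<gamma> > 0"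
    show "\<exists>i<n. dderivs n vs c (\<gamma> + unit_expo i) > 0"
    proof (rule ccontr)
      assume "\<not> ?thesis"
      then have "dderivs n vs c (\<gamma> + unit_expo i) = 0" if "i < n" for i
        using nn[of "\<gamma> + unit_expo i"] that by (meson order_antisym not_less)
      then have "dderivs n (v # vs) c \<gamma> = 0" by (simp add: dderiv_def)
      with pos show False by simp
    qed
  next
    assume "\<exists>i<n. dderivs n vs c (\<gamma> + unit_expo i) > 0"
    then obtain i where i: "i < n" "dderivs n vs c (\<gamma> + unit_expo i) > 0" by blast
    then have "0 < v i * dderivs n vs c (\<gamma> + unit_expo i)" using v by simp
    also have "\<dots> \<le> dderivs n (v # vs) c \<gamma>"
      using i(1) terms unfolding dderivs_simps dderiv_def
      by (intro member_le_sum[where f = "\<lambda>i. v i * dderivs n vs c (\<gamma> + unit_expo i)"]) auto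
    finally show "dderivs n (v # vs) c \<gamma> > 0" .
  qed
  also have "\<dots> \<longleftrightarrow> (\<exists>\<beta>\<in>Delta n (length (v # vs)). c (\<gamma> + \<beta>) > 0)"
  proof
    assume "\<exists>i<n. dderivs n vs c (\<gamma> + unit_expo i) > 0"
    then obtain i \<beta> where "i < n" "\<beta> \<in> Delta n (length vs)" "c (\<gamma> + unit_expo i + \<beta>) > 0"
      by (auto simp: IH)
    then show "\<exists>\<beta>\<in>Delta n (length (v # vs)). c (\<gamma> + \<beta>) > 0"
      by (intro bexI[of _ "\<beta> + unit_expo i"]) (simp_all add: Delta_add_unit add_ac)
  next
    assume "\<exists>\<beta>\<in>Delta n (length (v # vs)). c (\<gamma> + \<beta>) > 0"
    then obtain \<beta> where \<beta>: "\<beta> \<in> Delta n (Suc (length vs))" "c (\<gamma> + \<beta>) > 0" by auto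
    then obtain i \<beta>' where "i < n" "\<beta>' \<in> Delta n (length vs)" "\<beta> = \<beta>' + unit_expo i"
      by (meson Delta_Suc_obtain)
    then show "\<exists>i<n. dderivs n vs c (\<gamma> + unit_expo i) > 0"
      using \<beta>(2) by (auto simp: IH add_ac intro!: exI[of _ i] bexI[of _ \<beta>'])
  qed
  finally show ?case .
qed

text \<open>
  The exchange property makes the relevant graphs connected: \<open>i\<close> and \<open>j\<close> are adjacent if
  \<open>\<alpha> + e\<^sub>i + e\<^sub>j\<close> divides a monomial whose exponent is in \<open>J\<close>, and any two indices that are not
  isolated are adjacent or have a common neighbour.
\<close>

lemma M_convex_common_neighbour:
  assumes J: "M_convex n d J" and ij: "i < n" "j < n" "i \<noteq> j"
    and \<beta>: "\<beta> \<in> Delta n (Suc k)" "\<alpha> + unit_expo i + \<beta> \<in> J"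
    and \<gamma>: "\<alpha> + unit_expo j + \<gamma> \<in> J"
  shows "(\<exists>\<beta>'\<in>Delta n k. \<alpha> + unit_expo i + unit_expo j + \<beta>' \<in> J) \<or>
    (\<exists>a<n. \<exists>\<beta>'\<in>Delta n k. \<alpha> + unit_expo i + unit_expo a + \<beta>' \<in> J \<and>
       \<alpha> + unit_expo j + unit_expo a + \<beta>' \<in> J)"
proof -
  have split: "\<exists>\<beta>'\<in>Delta n k. \<beta> = \<beta>' + unit_expo l" if "l < n" "expo_at \<beta> l > 0" for l
    using Delta_add_unit[OF that(1), of "\<beta> - unit_expo l" k] expo_minus_unit[OF that(2)] \<beta>(1)
    by (intro bexI[of _ "\<beta> - unit_expo l"]) auto
  show ?thesis
  proof (cases "expo_at \<beta> j > 0")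
    case True
    then show ?thesis using split[OF ij(2)] \<beta>(2) by (auto simp: add_ac)
  next
    case False
    then have "expo_at (\<alpha> + unit_expo i + \<beta>) j < expo_at (\<alpha> + unit_expo j + \<gamma>) j"
      using ij(3) by (simp add: lookup_add lookup_single)
    then obtain l where l: "l < n" "expo_at (\<alpha> + unit_expo i + \<beta>) l > expo_at (\<alpha> + unit_expo j + \<gamma>) l"
      "\<alpha> + unit_expo i + \<beta> + unit_expo j - unit_expo l \<in> J"
      using J \<beta>(2) \<gamma> ij(2) unfolding M_convex_def by metis
    show ?thesis
    proof (cases "expo_at \<beta> l > 0")
      case True
      then obtain \<beta>' where \<beta>': "\<beta>' \<in> Delta n k" "\<beta> = \<beta>' + unit_expo l" using split l(1) by blast
      have "\<alpha> + unit_expo i + \<beta> + unit_expo j - unit_expo l =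
          (\<alpha> + unit_expo i + unit_expo j + \<beta>') + unit_expo l - unit_expo l"
        unfolding \<beta>' by (simp add: add_ac)
      then show ?thesis using l(3) \<beta>'(1) by auto
    next
      case False
      then have "l = i" using l(2) by (auto simp: lookup_add lookup_single when_def split: if_splits)
      have "\<alpha> + unit_expo i + \<beta> + unit_expo j - unit_expo l =
          (\<alpha> + unit_expo j + \<beta>) + unit_expo i - unit_expo i"
        unfolding \<open>l = i\<close> by (simp add: add_ac)
      then have *: "\<alpha> + unit_expo j + \<beta> \<in> J" using l(3) by simp
      obtain a \<beta>' where a: "a < n" "\<beta>' \<in> Delta n k" "\<beta> = \<beta>' + unit_expo a"
        using \<beta>(1) by (rule Delta_Suc_obtain)
      then have "\<alpha> + unit_expo i + unit_expo a + \<beta>' \<in> J" "\<alpha> + unit_expo j + unit_expo a + \<beta>' \<in> J"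
        using * \<beta>(2) by (simp_all add: add_ac)
      then show ?thesis using a by blast
    qed
  qed
qed

text \<open>
  The entries are those of the Hessian of \<open>D\<^sub>v \<dots> D\<^sub>w \<partial>\<^sup>\<alpha> f\<close>, where \<open>v, \<dots>, w\<close> are the directions in
  \<open>vs\<close> and \<open>c\<close> lists the normalized coefficients of \<open>f\<close>.  Each step of the induction replaces one
  partial derivative by a derivative in a positive direction.
\<close>

proposition reverse_CS_mixed_derivatives:
  assumes J: "M_convex n d J" and c: "\<And>\<gamma>. c \<gamma> \<ge> 0" and supp: "\<And>\<gamma>. c \<gamma> > 0 \<longleftrightarrow> \<gamma> \<in> J"
    and quad: "\<And>\<alpha>. \<alpha> \<in> Delta n (d - 2) \<Longrightarrow> reverse_CS n (\<lambda>i j. c (\<alpha> + unit_expo i + unit_expo j))"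
    and "\<And>v i. v \<in> set vs \<Longrightarrow> i < n \<Longrightarrow> v i > 0" and "length vs + k + 2 = d" and "\<alpha> \<in> Delta n k"
  shows "reverse_CS n (\<lambda>i j. dderivs n vs c (\<alpha> + unit_expo i + unit_expo j))"
  using assms(5-)
proof (induction vs arbitrary: \<alpha> k)
  case Nil
  then have "k = d - 2" by simp
  then show ?case using quad Nil by simp
next
  case (Cons v vs)
  have pos_vs: "\<And>v i. v \<in> set vs \<Longrightarrow> i < n \<Longrightarrow> v i > 0" using Cons.prems by simp
  define T where "T = (\<lambda>l i j. dderivs n vs c (\<alpha> + unit_expo l + unit_expo i + unit_expo j))"
  define H where "H = (\<lambda>i j. dderivs n (v # vs) c (\<alpha> + unit_expo i + unit_expo j))"
  have H_pos: "H i j > 0 \<longleftrightarrow> (\<exists>\<beta>\<in>Delta n (Suc (length vs)). \<alpha> + unit_expo i + unit_expo j + \<beta> \<in> J)" for i j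
    unfolding H_def using dderivs_pos_iff[OF c, of "v # vs" n] Cons.prems(1) by (simp add: supp)
  show ?case
    unfolding H_def[symmetric]
  proof (rule reverse_CS_local_to_global[where T = T and v = v])
    show "H = (\<lambda>i j. \<Sum>l<n. v l * T l i j)"
      by (simp add: H_def T_def dderiv_def add_ac fun_eq_iff)
    show "reverse_CS n (T l)" if "l < n" for l
      unfolding T_def
      by (rule Cons.IH[of "Suc k"]) (use Cons.prems Delta_add_unit[OF that] in auto)
    show "T l i j \<ge> 0" for l i j unfolding T_def by (rule dderivs_nonneg) (use c pos_vs in auto)
  next
    fix i j k m assume *: "i < n" "j < n" "i \<noteq> j" "k < n" "m < n" "H i k > 0" "H j m > 0"
    then obtain \<beta> \<gamma> where \<beta>: "\<beta> \<in> Delta n (Suc (length vs))" "\<alpha> + unit_expo i + unit_expo k + \<beta> \<in> J"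
      and \<gamma>: "\<alpha> + unit_expo j + unit_expo m + \<gamma> \<in> J" by (auto simp: H_pos)
    have "\<beta> + unit_expo k \<in> Delta n (Suc (Suc (length vs)))" using \<beta>(1) *(4) by (simp add: Delta_add_unit)
    moreover have "\<alpha> + unit_expo i + (\<beta> + unit_expo k) \<in> J" "\<alpha> + unit_expo j + (\<gamma> + unit_expo m) \<in> J"
      using \<beta>(2) \<gamma> by (simp_all add: add_ac)
    ultimately show "H i j > 0 \<or> (\<exists>a<n. H i a > 0 \<and> H j a > 0)"
      unfolding H_pos using M_convex_common_neighbour[OF J *(1-3)] by blast
  qed (use Cons.prems(1) in \<open>auto simp: T_def add_ac\<close>)
qed

section \<open>Approximation by strictly Lorentzian polynomials\<close>

lemma ncoef_pos_iff: "ncoef f \<alpha> > 0 \<longleftrightarrow> coef f \<alpha> > 0"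
  using expo_fact_pos[of \<alpha>] by (simp add: ncoef_def zero_less_mult_iff)

text \<open>
  The vector \<open>e\<^sub>j + t (1, \<dots>, 1)\<close>.
\<close>

definition near_unit :: "real \<Rightarrow> nat \<Rightarrow> nat \<Rightarrow> real" where
  "near_unit t j i = (if i = j then 1 else 0) + t"

text \<open>
  The list that contains \<open>near_unit t j\<close> with multiplicity \<open>\<beta>\<^sub>j\<close>.  The derivative of \<open>f\<close> in these
  directions is the normalized coefficient at \<open>\<beta>\<close> of \<open>f(V x)\<close>, where the columns of \<open>V\<close> are the
  vectors \<open>near_unit t j\<close>.
\<close>

definition near_unit_dirs :: "nat \<Rightarrow> real \<Rightarrow> expo \<Rightarrow> (nat \<Rightarrow> real) list" where
  "near_unit_dirs n t \<beta> = concat (map (\<lambda>j. replicate (expo_at \<beta> j) (near_unit t j)) [0..<n])"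

lemma near_unit_pos: "t > 0 \<Longrightarrow> near_unit t j i > 0"
  by (simp add: near_unit_def)

lemma near_unit_dirs_pos: "t > 0 \<Longrightarrow> v \<in> set (near_unit_dirs n t \<beta>) \<Longrightarrow> v i > 0"
  by (auto simp: near_unit_dirs_def near_unit_pos)

lemma near_unit_dirs_0 [simp]: "near_unit_dirs n t 0 = []"
  by (simp add: near_unit_dirs_def)

lemma mset_near_unit_dirs: "mset (near_unit_dirs n t \<beta>) = (\<Sum>j<n. replicate_mset (expo_at \<beta> j) (near_unit t j))"
  unfolding near_unit_dirs_def by (induction n) simp_all

lemma mset_near_unit_dirs_add_unit:
  assumes "i < n"
  shows "mset (near_unit_dirs n t (\<beta> + unit_expo i)) = mset (near_unit t i # near_unit_dirs n t \<beta>)"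
proof -
  have "(\<Sum>j<n. replicate_mset (expo_at (\<beta> + unit_expo i) j) (near_unit t j)) =
      (\<Sum>j<n. (if j = i then {#near_unit t i#} else {#}) + replicate_mset (expo_at \<beta> j) (near_unit t j))"
    by (intro sum.cong refl) (auto simp: lookup_add lookup_single One_nat_def)
  then show ?thesis using assms by (simp add: mset_near_unit_dirs sum.distrib)
qed

lemma dderivs_near_unit_dirs_add_unit:
  "i < n \<Longrightarrow> dderivs n (near_unit_dirs n t (\<beta> + unit_expo i)) c =
     dderiv n (near_unit t i) (dderivs n (near_unit_dirs n t \<beta>) c)"
  using dderivs_cong_mset[OF mset_near_unit_dirs_add_unit] by simp

lemma length_near_unit_dirs: "\<beta> \<in> Delta n d \<Longrightarrow> length (near_unit_dirs n t \<beta>) = d"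
proof (induction d arbitrary: \<beta>)
  case (Suc d)
  from Suc.prems obtain i \<beta>' where "i < n" "\<beta>' \<in> Delta n d" "\<beta> = \<beta>' + unit_expo i"
    by (rule Delta_Suc_obtain)
  then show ?case using mset_eq_length[OF mset_near_unit_dirs_add_unit] Suc.IH by simp
qed (simp add: Delta_0)

lemma tendsto_dderivs_near_unit_dirs:
  assumes "t \<longlonglongrightarrow> 0" and "\<beta> \<in> Delta n d"
  shows "(\<lambda>m. dderivs n (near_unit_dirs n (t m) \<beta>) c \<gamma>) \<longlonglongrightarrow> c (\<gamma> + \<beta>)"
  using assms(2)
proof (induction d arbitrary: \<beta> \<gamma>)
  case (Suc d)
  from Suc.prems obtain i \<beta>' where i: "i < n" "\<beta>' \<in> Delta n d" "\<beta> = \<beta>' + unit_expo i"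
    by (rule Delta_Suc_obtain)
  have nu: "(\<lambda>m. near_unit (t m) i a) \<longlonglongrightarrow> (if a = i then 1 else 0)" for a
    unfolding near_unit_def using tendsto_add[OF tendsto_const assms(1)] by fastforce
  have "(\<lambda>m. dderiv n (near_unit (t m) i) (dderivs n (near_unit_dirs n (t m) \<beta>') c) \<gamma>)
      \<longlonglongrightarrow> (\<Sum>a<n. (if a = i then 1 else 0) * c (\<gamma> + unit_expo a + \<beta>'))"
    unfolding dderiv_def by (intro tendsto_sum tendsto_mult nu Suc.IH i(2))
  also have "(\<Sum>a<n. (if a = i then 1 else 0) * c (\<gamma> + unit_expo a + \<beta>')) =
      (\<Sum>a<n. if a = i then c (\<gamma> + unit_expo a + \<beta>') else 0)"
    by (intro sum.cong) auto
  also have "\<dots> = c (\<gamma> + \<beta>)"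
    using i(1) by (simp add: i(3) add_ac)
  finally show ?case using i(1) by (simp add: i(3) dderivs_near_unit_dirs_add_unit)
qed (simp add: Delta_0)

text \<open>
  The Hessians of \<open>\<Sum>\<^sub>\<beta> x\<^sup>\<beta>\<close> are positive definite: the entry at \<open>(i, j)\<close> is
  \<open>\<alpha>! w\<^sub>i w\<^sub>j\<close>, plus \<open>\<alpha>! w\<^sub>i\<close> if \<open>i = j\<close>, where \<open>w\<^sub>i = \<alpha>\<^sub>i + 1\<close>.
\<close>

lemma expo_fact_form_pos:
  assumes "\<exists>i<n. x i \<noteq> 0"
  shows "bform n (\<lambda>i j. expo_fact (\<alpha> + unit_expo i + unit_expo j)) x x > 0"
proof -
  define w where "w = (\<lambda>i. real (expo_at \<alpha> i + 1))"
  have f: "expo_fact (\<alpha> + unit_expo i + unit_expo j) = expo_fact \<alpha> * (w i * w j + (if i = j then w i else 0))" for i j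
    unfolding expo_fact_add_unit by (simp add: w_def lookup_add lookup_single algebra_simps)
  have entry: "expo_fact (\<alpha> + unit_expo i + unit_expo j) * x i * x j =
      expo_fact \<alpha> * ((w i * x i) * (w j * x j)) + (if i = j then expo_fact \<alpha> * (w i * (x i)\<^sup>2) else 0)" for i j
    unfolding f by (simp add: power2_eq_square algebra_simps)
  have "bform n (\<lambda>i j. expo_fact (\<alpha> + unit_expo i + unit_expo j)) x x =
      (\<Sum>i<n. \<Sum>j<n. expo_fact \<alpha> * ((w i * x i) * (w j * x j))) + (\<Sum>i<n. expo_fact \<alpha> * (w i * (x i)\<^sup>2))"
    unfolding bform_def entry by (simp add: sum.distrib)
  also have "\<dots> = expo_fact \<alpha> * ((\<Sum>i<n. w i * x i)\<^sup>2 + (\<Sum>i<n. w i * (x i)\<^sup>2))"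
    unfolding power2_eq_square[of "sum _ _"] sum_product
    by (simp add: sum_distrib_left distrib_left)
  also have "\<dots> > 0"
  proof (intro mult_pos_pos add_nonneg_pos expo_fact_pos)
    obtain i where i: "i < n" "x i \<noteq> 0" using assms by blast
    then have "0 < w i * (x i)\<^sup>2" by (simp add: w_def)
    also have "\<dots> \<le> (\<Sum>i<n. w i * (x i)\<^sup>2)"
      using i(1) by (intro member_le_sum) (auto simp: w_def)
    finally show "0 < (\<Sum>i<n. w i * (x i)\<^sup>2)" .
  qed simp
  finally show ?thesis .
qed

text \<open>
  The polynomial \<open>f(V x) - s \<Sum>\<^sub>\<beta> x\<^sup>\<beta>\<close>, where \<open>c\<close> lists the normalized coefficients of \<open>f\<close>.
\<close>

definition perturbed_poly :: "nat \<Rightarrow> nat \<Rightarrow> (expo \<Rightarrow> real) \<Rightarrow> real \<Rightarrow> real \<Rightarrow> rpoly" where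
  "perturbed_poly n d c t s = (\<Sum>\<beta>\<in>Delta n d. Poly_Mapping.single \<beta>
     (dderivs n (near_unit_dirs n t \<beta>) c 0 / expo_fact \<beta> - s))"

lemma coef_perturbed_poly:
  "coef (perturbed_poly n d c t s) \<beta> =
     (if \<beta> \<in> Delta n d then dderivs n (near_unit_dirs n t \<beta>) c 0 / expo_fact \<beta> - s else 0)"
  unfolding perturbed_poly_def by (rule sum_single_lookup[OF finite_Delta])

lemma ncoef_perturbed_poly:
  "\<beta> \<in> Delta n d \<Longrightarrow>
     ncoef (perturbed_poly n d c t s) \<beta> = dderivs n (near_unit_dirs n t \<beta>) c 0 - s * expo_fact \<beta>"
  using expo_fact_pos[of \<beta>] by (simp add: ncoef_def coef_perturbed_poly algebra_simps)

lemma strictly_Lorentzian_perturbed_poly: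
  assumes "n \<ge> 1" "d \<ge> 2" and t: "t > 0" and J: "M_convex n d J"
    and c: "\<And>\<gamma>. c \<gamma> \<ge> 0" and supp: "\<And>\<gamma>. c \<gamma> > 0 \<longleftrightarrow> \<gamma> \<in> J"
    and quad: "\<And>\<alpha>. \<alpha> \<in> Delta n (d - 2) \<Longrightarrow> reverse_CS n (\<lambda>i j. c (\<alpha> + unit_expo i + unit_expo j))"
  shows "\<forall>\<^sub>F s in at_right 0. strictly_Lorentzian n d (perturbed_poly n d c t s)"
proof -
  define C where "C = (\<lambda>\<beta>. dderivs n (near_unit_dirs n t \<beta>) c 0)"
  define H where "H = (\<lambda>\<alpha> i j. C (\<alpha> + unit_expo i + unit_expo j))"
  define M where "M = (\<lambda>\<alpha> i j. expo_fact (\<alpha> + unit_expo i + unit_expo j))"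
  define one where "one = (\<lambda>i::nat. 1::real)"
  have C_pos: "C \<beta> > 0" if "\<beta> \<in> Delta n d" for \<beta>
  proof -
    obtain \<gamma> where "\<gamma> \<in> J" "\<gamma> \<in> Delta n d" using J by (auto simp: M_convex_def)
    then have "\<exists>\<gamma>\<in>Delta n (length (near_unit_dirs n t \<beta>)). c (0 + \<gamma>) > 0"
      using length_near_unit_dirs[OF that] supp by auto
    then show ?thesis
      unfolding C_def using dderivs_pos_iff[of c "near_unit_dirs n t \<beta>" n 0] c near_unit_dirs_pos[OF t] by blast
  qed
  note D2 = Delta_add_two_units[OF \<open>d \<ge> 2\<close>]
  have H_sym: "symmetric_on n (H \<alpha>)" and M_sym: "symmetric_on n (M \<alpha>)" for \<alpha>
    by (simp_all add: H_def M_def symmetric_on_def add_ac)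
  have H_CS: "reverse_CS n (H \<alpha>)" if \<alpha>: "\<alpha> \<in> Delta n (d - 2)" for \<alpha>
  proof -
    have "reverse_CS n (\<lambda>a b. dderivs n (near_unit_dirs n t \<alpha>) c (0 + unit_expo a + unit_expo b))"
      using reverse_CS_mixed_derivatives[OF J c supp quad, of "near_unit_dirs n t \<alpha>" 0 0]
        near_unit_dirs_pos[OF t] length_near_unit_dirs[OF \<alpha>] \<open>d \<ge> 2\<close> by (simp add: Delta_0)
    from reverse_CS_congruence[OF this, of "near_unit t"]
    have "reverse_CS n (\<lambda>i j. \<Sum>a<n. \<Sum>b<n. near_unit t i a * near_unit t j b *
        dderivs n (near_unit_dirs n t \<alpha>) c (0 + unit_expo a + unit_expo b))" .
    also have "?this \<longleftrightarrow> reverse_CS n (H \<alpha>)"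
    proof (rule reverse_CS_cong)
      fix i j assume ij: "i < n" "j < n"
      have "H \<alpha> i j = dderiv n (near_unit t i) (dderiv n (near_unit t j) (dderivs n (near_unit_dirs n t \<alpha>) c)) 0"
        unfolding H_def C_def dderivs_near_unit_dirs_add_unit[OF ij(2)] dderivs_near_unit_dirs_add_unit[OF ij(1)]
        by (subst dderiv_commute) (rule refl)
      also have "\<dots> = (\<Sum>a<n. \<Sum>b<n. near_unit t i a * near_unit t j b *
          dderivs n (near_unit_dirs n t \<alpha>) c (0 + unit_expo a + unit_expo b))"
        by (simp add: dderiv_def sum_distrib_left mult.assoc)
      finally show "(\<Sum>a<n. \<Sum>b<n. near_unit t i a * near_unit t j b *
          dderivs n (near_unit_dirs n t \<alpha>) c (0 + unit_expo a + unit_expo b)) = H \<alpha> i j" ..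
    qed
    finally show ?thesis .
  qed
  have H_pos: "bform n (H \<alpha>) one one > 0" if \<alpha>: "\<alpha> \<in> Delta n (d - 2)" for \<alpha>
    unfolding bform_def one_def H_def using \<open>n \<ge> 1\<close> C_pos D2[OF \<alpha>]
    by (intro sum_pos) (auto simp: lessThan_empty_iff)
  have M_pos: "bform n (M \<alpha>) one one > 0" for \<alpha>
    unfolding M_def using \<open>n \<ge> 1\<close> by (intro expo_fact_form_pos exI[of _ 0]) (auto simp: one_def)
  have "\<forall>\<^sub>F s in at_right 0. (\<forall>\<beta>\<in>Delta n d. s < C \<beta> / expo_fact \<beta>) \<and>
      (\<forall>\<alpha>\<in>Delta n (d - 2). s < bform n (H \<alpha>) one one / bform n (M \<alpha>) one one) \<and> s > 0"
    using C_pos H_pos M_pos expo_fact_pos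
    by (intro eventually_conj eventually_ball_finite finite_Delta ballI eventually_at_right_less
        order_tendstoD(2)[OF tendsto_ident_at] divide_pos_pos) auto
  then show ?thesis
  proof eventually_elim
    case (elim s)
    let ?F = "perturbed_poly n d c t s"
    show ?case
      unfolding strictly_Lorentzian_def
    proof (intro conjI allI ballI)
      show "homogeneous_poly n d ?F"
        by (auto simp: homogeneous_poly_def in_keys_iff coef_perturbed_poly split: if_splits)
      show "coef ?F \<beta> \<ge> 0" for \<beta>
        using elim by (auto simp: coef_perturbed_poly C_def less_imp_le)
    next
      fix \<alpha> assume \<alpha>: "\<alpha> \<in> Delta n (d - 2)"
      define A where "A = (\<lambda>i j. H \<alpha> i j + (- s) * M \<alpha> i j)"
      have hess: "quadratic_hessian n (multi_mpderiv n \<alpha> ?F) = Matrix.mat n n (\<lambda>(i, j). A i j)"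
        unfolding quadratic_hessian_eq[OF Delta_keys[OF \<alpha>]]
        by (rule cong_mat) (auto simp: A_def H_def M_def C_def ncoef_perturbed_poly D2[OF \<alpha>])
      have A_sym: "symmetric_on n A"
        using H_sym[of \<alpha>] M_sym[of \<alpha>] by (simp add: A_def symmetric_on_def)
      have A_form: "bform n A x x = bform n (H \<alpha>) x x - s * bform n (M \<alpha>) x x" for x
        by (simp add: bform_def A_def algebra_simps sum.distrib sum_distrib_left sum_subtractf)
      have "s < bform n (H \<alpha>) one one / bform n (M \<alpha>) one one" using elim \<alpha> by blast
      then have A_pos: "bform n A one one > 0"
        unfolding pos_less_divide_eq[OF M_pos] by (simp add: A_form)
      \<comment> \<open>By the reverse Cauchy--Schwarz inequality, \<open>H \<alpha>\<close> is nonpositive on the orthogonal complement of its row sums.\<close>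
      have A_neg: "bform n A x x < 0"
        if "ip n (\<lambda>i. \<Sum>j<n. H \<alpha> i j * one j) x = 0" "\<exists>i<n. x i \<noteq> 0" for x
      proof -
        have "bform n (H \<alpha>) one x = 0"
          using that(1) by (subst bform_commute[OF H_sym]) (simp add: bform_eq_ip ip_commute)
        then have "bform n (H \<alpha>) one one * bform n (H \<alpha>) x x \<le> 0"
          using H_CS[OF \<alpha>] H_pos[OF \<alpha>] unfolding reverse_CS_def by (metis power_zero_numeral)
        then have "bform n (H \<alpha>) x x \<le> 0" using H_pos[OF \<alpha>] by (simp add: mult_le_0_iff)
        moreover have "s * bform n (M \<alpha>) x x > 0"
          using expo_fact_form_pos[OF that(2), of \<alpha>] elim by (simp add: M_def)
        ultimately show ?thesis by (simp add: A_form)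
      qed
      show "num_pos_eigenvalues (quadratic_hessian n (multi_mpderiv n \<alpha> ?F)) = 1"
        "num_neg_eigenvalues (quadratic_hessian n (multi_mpderiv n \<alpha> ?F)) = n - 1"
        unfolding hess by (rule lorentzian_signature_eigenvalues[OF A_sym A_pos A_neg]; assumption)+
    qed
  qed
qed

text \<open>
  For each \<open>t = 1 / (m + 1)\<close> some \<open>s\<close> with \<open>0 < s < t\<close> makes the perturbed polynomial strictly
  Lorentzian.
\<close>

theorem Lorentzian_if_reverse_CS:
  assumes nd: "n \<ge> 1" "d \<ge> 2" and J: "M_convex n d J"
    and f: "\<And>\<alpha>. coef f \<alpha> \<ge> 0" "supp f = J"
    and quad: "\<And>\<alpha>. \<alpha> \<in> Delta n (d - 2) \<Longrightarrow>
      reverse_CS n (\<lambda>i j. ncoef f (\<alpha> + unit_expo i + unit_expo j))"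
  shows "Lorentzian n d f"
proof -
  have c: "ncoef f \<gamma> \<ge> 0" for \<gamma> using f(1) expo_fact_pos[of \<gamma>] by (simp add: ncoef_def)
  have "coef f \<gamma> > 0 \<longleftrightarrow> \<gamma> \<in> J" for \<gamma>
    using f(1)[of \<gamma>] f(2) by (auto simp: in_keys_iff less_le)
  then have supp: "ncoef f \<gamma> > 0 \<longleftrightarrow> \<gamma> \<in> J" for \<gamma> by (simp add: ncoef_pos_iff)
  define t where "t = (\<lambda>m. 1 / real (Suc m))"
  have t: "t m > 0" for m by (simp add: t_def)
  have t0: "t \<longlonglongrightarrow> 0" unfolding t_def by (rule LIMSEQ_Suc[OF lim_1_over_n])
  have "\<exists>s. 0 < s \<and> s < t m \<and> strictly_Lorentzian n d (perturbed_poly n d (ncoef f) (t m) s)" for m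
  proof -
    have "\<forall>\<^sub>F s in at_right 0. s > 0 \<and> s < t m \<and> strictly_Lorentzian n d (perturbed_poly n d (ncoef f) (t m) s)"
      using t[of m]
      by (intro eventually_conj eventually_at_right_less order_tendstoD(2)[OF tendsto_ident_at]
          strictly_Lorentzian_perturbed_poly[OF nd t J c supp quad])
    then show ?thesis using eventually_happens'[OF trivial_limit_at_right_real] by blast
  qed
  then obtain s where s: "\<And>m. 0 < s m" "\<And>m. s m < t m"
    and strict: "\<And>m. strictly_Lorentzian n d (perturbed_poly n d (ncoef f) (t m) (s m))" by metis
  have s0: "s \<longlonglongrightarrow> 0"
    by (rule tendsto_sandwich[OF _ _ tendsto_const t0]) (use s in \<open>auto intro: less_imp_le always_eventually\<close>)
  have "(\<lambda>m. coef (perturbed_poly n d (ncoef f) (t m) (s m)) \<beta>) \<longlonglongrightarrow> coef f \<beta>" for \<beta>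
  proof (cases "\<beta> \<in> Delta n d")
    case True
    have "(\<lambda>m. dderivs n (near_unit_dirs n (t m) \<beta>) (ncoef f) 0 / expo_fact \<beta> - s m)
        \<longlonglongrightarrow> ncoef f (0 + \<beta>) / expo_fact \<beta> - 0"
      using expo_fact_pos[of \<beta>]
      by (intro tendsto_intros tendsto_dderivs_near_unit_dirs[OF t0 True] s0) auto
    then show ?thesis using True expo_fact_pos[of \<beta>] by (simp add: coef_perturbed_poly ncoef_def)
  next
    case False
    then have "\<beta> \<notin> supp f" using J f(2) by (auto simp: M_convex_def)
    then show ?thesis using False by (simp add: coef_perturbed_poly in_keys_iff)
  qed
  moreover have "homogeneous_poly n d f" using J f(2) by (simp add: homogeneous_poly_def M_convex_def)
  ultimately show ?thesis unfolding Lorentzian_def using strict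
    by (intro conjI exI[of _ "\<lambda>m. perturbed_poly n d (ncoef f) (t m) (s m)"]) auto
qed

section \<open>From weak representations to Lorentzian polynomials\<close>

lemma sum_powr_le:
  fixes b c q :: real
  assumes q: "0 < q" "q \<le> 1" and "0 \<le> c" "c \<le> b"
  shows "(b powr (1 / q) + c powr (1 / q)) powr q \<le> b + q * c"
proof (cases "b = 0")
  case False
  then have b: "b > 0" using assms by simp
  define u where "u = (c / b) powr (1 / q)"
  have "u \<le> c / b"
  proof (cases "c = 0")
    case False
    have "(c / b) powr (1 / q) \<le> (c / b) powr 1"
      using assms b False by (intro powr_mono') auto
    then show ?thesis using assms b False by (simp add: u_def)
  qed (simp add: u_def)
  have "u \<ge> 0" by (simp add: u_def)
  have "b powr (1 / q) + c powr (1 / q) = b powr (1 / q) * (1 + u)"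
    using assms b by (simp add: u_def powr_divide distrib_left)
  then have "(b powr (1 / q) + c powr (1 / q)) powr q = b * (1 + u) powr q"
    using b q \<open>u \<ge> 0\<close> by (simp add: powr_mult powr_powr)
  also have "(1 + u) powr q \<le> 1 + q * u"
    using Youngs_inequality_0[of q "1 - q" "1 + u" 1] q \<open>u \<ge> 0\<close> by (simp add: algebra_simps)
  also have "\<dots> \<le> 1 + q * (c / b)"
    using mult_left_mono[OF \<open>u \<le> c / b\<close>, of q] q by simp
  finally have "(b powr (1 / q) + c powr (1 / q)) powr q \<le> b * (1 + q * (c / b))"
    using b by simp
  then show ?thesis using b by (simp add: distrib_left)
next
  case True
  then have "c = 0" using assms by simp
  then show ?thesis using True by simp
qed

text \<open>
  If \<open>a\<close> is much smaller than \<open>b\<close>, then \<open>c\<close> exceeds \<open>b\<close> by at most the small amount \<open>q a\<close>; the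
  cruder bound \<open>2\<^sup>q max a b\<close> would not suffice for the estimate of the quadratic form.
\<close>

lemma T_relation_bound:
  assumes q: "0 < q" "q \<le> 1" and "0 \<le> a" "0 \<le> b" "0 \<le> c" and T: "T_relation q a b c"
  shows "c \<le> max a b + q * min a b"
proof -
  have "c = (c powr (1 / q)) powr q" using assms by (simp add: powr_powr)
  also have "\<dots> \<le> (a powr (1 / q) + b powr (1 / q)) powr q"
    using T q by (intro powr_mono2) (auto simp: T_relation_def)
  also have "\<dots> \<le> max a b + q * min a b"
    using sum_powr_le[OF q, of a b] sum_powr_le[OF q, of b a] assms
    by (cases "a \<le> b") (auto simp: max_def min_def add.commute)
  finally show ?thesis .
qed

lemma T_relation_swap: "T_relation q a b c \<Longrightarrow> T_relation q b a c" "T_relation q a b c \<Longrightarrow> T_relation q a c b"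
  unfolding T_relation_def by linarith+

lemma T_relation_trivial: "T_relation q a a a" "T_relation q a a 0" "T_relation q a 0 a" "T_relation q 0 a a"
  by (simp_all add: T_relation_def)

text \<open>
  A statement about four indices that is invariant under adjacent transpositions may be proved for
  increasing indices only.
\<close>

lemma symmetric_four_argument_rule:
  fixes P :: "nat \<Rightarrow> nat \<Rightarrow> nat \<Rightarrow> nat \<Rightarrow> bool"
  assumes s12: "\<And>i j k l. P i j k l \<Longrightarrow> P j i k l" and s23: "\<And>i j k l. P i j k l \<Longrightarrow> P i k j l"
    and s34: "\<And>i j k l. P i j k l \<Longrightarrow> P i j l k"
    and sorted: "\<And>i j k l. i \<le> j \<Longrightarrow> j \<le> k \<Longrightarrow> k \<le> l \<Longrightarrow> P i j k l"
  shows "P i j k l"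
proof -
  have A: "P a b c d" if "a \<le> b" "b \<le> c" for a b c d
  proof -
    consider "c \<le> d" | "b \<le> d" "d \<le> c" | "a \<le> d" "d \<le> b" | "d \<le> a" by linarith
    then show ?thesis
    proof cases
      case 1 then show ?thesis using sorted that by blast
    next
      case 2 then show ?thesis using s34 sorted that by blast
    next
      case 3 then show ?thesis using s34[OF s23[OF sorted[of a d b c]]] that by blast
    next
      case 4 then show ?thesis using s34[OF s23[OF s12[OF sorted[of d a b c]]]] that by blast
    qed
  qed
  have B: "P a b c d" if "a \<le> b" for a b c d
  proof -
    consider "b \<le> c" | "a \<le> c" "c \<le> b" | "c \<le> a" by linarith
    then show ?thesis
    proof cases
      case 1 then show ?thesis using A that by blast
    next
      case 2 then show ?thesis using s23[OF A[of a c b d]] by blast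
    next
      case 3 then show ?thesis using s23[OF s12[OF A[of c a b d]]] that by blast
    qed
  qed
  show ?thesis using B[of i j k l] s12[OF B[of j i k l]] by linarith
qed

text \<open>
  Outside the box between \<open>delta_minus J\<close> and \<open>delta_plus J\<close> the relation holds for trivial reasons:
  either all three products agree, or two of them agree and the third one is \<open>0\<close>.
\<close>

lemma weak_T_representation_all_indices:
  assumes J: "M_convex n d J" and "d \<ge> 2" and W: "weak_T_representation n d J q \<rho>" and \<alpha>: "\<alpha> \<in> Delta n (d - 2)"
    and "i < n" "j < n" "k < n" "l < n"
  defines "R \<equiv> \<lambda>a b. \<rho> (\<alpha> + unit_expo a + unit_expo b)"
  shows "T_relation q (R j k * R i l) (R i k * R j l) (R i j * R k l)"
proof -
  define P where "P = (\<lambda>i j k l. i < n \<and> j < n \<and> k < n \<and> l < n \<longrightarrow>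
    T_relation q (R j k * R i l) (R i k * R j l) (R i j * R k l))"
  have R_sym: "R a b = R b a" for a b by (simp add: R_def add_ac)
  have finJ: "finite J" using J finite_Delta finite_subset unfolding M_convex_def by metis
  have D2: "\<alpha> + unit_expo a + unit_expo b \<in> Delta n d" if "a < n" "b < n" for a b
    by (rule Delta_add_two_units[OF \<open>d \<ge> 2\<close> \<alpha> that])
  have bounds: "delta_minus J m \<le> expo_at \<alpha> m + (of_bool (a = m) + of_bool (b = m)) \<and>
      expo_at \<alpha> m + (of_bool (a = m) + of_bool (b = m)) \<le> delta_plus J m"
    if "a < n" "b < n" "R a b \<noteq> 0" for a b m
  proof -
    have "\<alpha> + unit_expo a + unit_expo b \<in> J"
      using W D2[OF that(1,2)] that(3) unfolding weak_T_representation_def R_def by blast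
    moreover have "expo_at (\<alpha> + unit_expo a + unit_expo b) m = expo_at \<alpha> m + (of_bool (a = m) + of_bool (b = m))"
      by (simp add: lookup_add lookup_single when_def)
    ultimately show ?thesis
      using finJ unfolding delta_minus_def delta_plus_def by (metis Min_le Max_ge finite_imageI imageI)
  qed
  have unit_at: "expo_at (unit_expo a) m = of_bool (a = m)" for a m
    by (simp add: lookup_single when_def)
  have "P i j k l"
  proof (rule symmetric_four_argument_rule)
    fix i j k l :: nat assume ord: "i \<le> j" "j \<le> k" "k \<le> l"
    show "P i j k l"
      unfolding P_def
    proof
      assume less: "i < n \<and> j < n \<and> k < n \<and> l < n"
      then have i: "i < n" and j: "j < n" and k: "k < n" and l: "l < n" by auto
      consider (lower) m where "m < n" "delta_minus J m > expo_at \<alpha> m"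
        | (upper) m where "m < n" "expo_at (\<alpha> + unit_expo i + unit_expo j + unit_expo k + unit_expo l) m > delta_plus J m"
        | (inside) "\<forall>m<n. delta_minus J m \<le> expo_at \<alpha> m"
            "\<forall>m<n. expo_at (\<alpha> + unit_expo i + unit_expo j + unit_expo k + unit_expo l) m \<le> delta_plus J m"
        by (meson not_le)
      then show "T_relation q (R j k * R i l) (R i k * R j l) (R i j * R k l)"
      proof cases
        case lower
        have R0: "R a b = 0" if "a < n" "b < n" "a \<noteq> m" "b \<noteq> m" for a b
          using bounds[of a b m] that lower by fastforce
        show ?thesis
          using R0[OF i j] R0[OF k l] R0[OF i k] R0[OF j l] R0[OF i l] R0[OF j k]
          by (cases "i = m"; cases "j = m"; cases "k = m"; cases "l = m"; simp add: T_relation_trivial R_sym mult.commute)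
      next
        case upper
        have R0: "R a b = 0" if "a < n" "b < n"
          "of_bool (i = m) + of_bool (j = m) + of_bool (k = m) + of_bool (l = m)
            \<le> (of_bool (a = m) + of_bool (b = m) :: nat)" for a b
        proof (rule ccontr)
          assume "R a b \<noteq> 0"
          then have "expo_at \<alpha> m + (of_bool (a = m) + of_bool (b = m)) \<le> delta_plus J m"
            using bounds that by blast
          also have "\<dots> < expo_at \<alpha> m + (of_bool (i = m) + of_bool (j = m) + of_bool (k = m) + of_bool (l = m))"
            using upper(2) by (simp add: lookup_add unit_at)
          finally show False using that(3) by simp
        qed
        show ?thesis
          using R0[OF i j] R0[OF k l] R0[OF i k] R0[OF j l] R0[OF i l] R0[OF j k]
          by (cases "i = m"; cases "j = m"; cases "k = m"; cases "l = m"; simp add: T_relation_trivial R_sym mult.commute)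
      next
        case inside
        then show ?thesis
          using W \<alpha> less ord unfolding weak_T_representation_def R_def by blast
      qed
    qed
  qed (auto simp: P_def R_sym mult.commute dest: T_relation_swap)
  then show ?thesis using assms unfolding P_def by blast
qed

lemma coef_repr_poly:
  "finite J \<Longrightarrow> coef (repr_poly J \<rho>) \<alpha> = (if \<alpha> \<in> J then \<rho> \<alpha> / expo_fact \<alpha> else 0)"
  unfolding repr_poly_def by (rule sum_single_lookup)

text \<open>
  Up to a diagonal congruence, the Hessian of the normalized polynomial is the matrix
  \<open>R\<^sub>i\<^sub>j = \<rho>(\<alpha> + e\<^sub>i + e\<^sub>j)\<close> with its diagonal multiplied by \<open>\<theta>\<^sub>i = (\<alpha>\<^sub>i + 1) / (\<alpha>\<^sub>i + 2)\<close>.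
\<close>

lemma Nop_repr_poly_Lorentzian:
  assumes nd: "n \<ge> 1" "d \<ge> 2" and J: "M_convex n d J"
    and q: "q = 1 / (real d * 2 ^ (n + 4))" and W: "weak_T_representation n d J q \<rho>"
  shows "Nop (repr_poly J \<rho>) \<in> Lorentzian_with_support n d J"
proof -
  let ?f = "Nop (repr_poly J \<rho>)"
  have JD: "J \<subseteq> Delta n d" using J by (simp add: M_convex_def)
  have finJ: "finite J" using JD finite_Delta finite_subset by blast
  have "\<forall>\<beta>\<in>Delta n d. \<rho> \<beta> \<ge> 0" "{\<beta> \<in> Delta n d. \<rho> \<beta> \<noteq> 0} = J"
    using W unfolding weak_T_representation_def by simp_all
  then have \<rho>: "\<And>\<beta>. \<beta> \<in> Delta n d \<Longrightarrow> \<rho> \<beta> \<ge> 0" "\<And>\<beta>. \<beta> \<in> Delta n d \<Longrightarrow> \<rho> \<beta> \<noteq> 0 \<longleftrightarrow> \<beta> \<in> J"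
    by auto
  have coef: "coef ?f \<beta> = (if \<beta> \<in> J then \<rho> \<beta> / expo_fact \<beta> / expo_fact \<beta> else 0)" for \<beta>
    by (simp add: coef_Nop coef_repr_poly[OF finJ])
  have nonneg: "coef ?f \<beta> \<ge> 0" for \<beta>
    using \<rho>(1) JD expo_fact_pos[of \<beta>] by (auto simp: coef subset_iff less_imp_le)
  have "coef ?f \<beta> \<noteq> 0 \<longleftrightarrow> \<beta> \<in> J" for \<beta>
    using \<rho>(2)[of \<beta>] JD expo_fact_pos[of \<beta>] by (auto simp: coef)
  then have supp: "supp ?f = J" by (auto simp: in_keys_iff)
  have "(2::real) * 1 \<le> real d * 2 ^ (n + 4)"
    using nd by (intro mult_mono) (auto intro: one_le_power)
  then have "real d * 2 ^ (n + 4) \<ge> 1" by linarith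
  then have q01: "0 < q" "q \<le> 1" unfolding q using nd by (simp_all add: divide_le_eq_1)
  note D2 = Delta_add_two_units[OF nd(2)]
  have "Lorentzian n d ?f"
  proof (rule Lorentzian_if_reverse_CS[OF nd J nonneg supp])
    fix \<alpha> assume \<alpha>: "\<alpha> \<in> Delta n (d - 2)"
    define R where "R = (\<lambda>a b. \<rho> (\<alpha> + unit_expo a + unit_expo b))"
    define \<theta> where "\<theta> = (\<lambda>i. 1 - 1 / (real (expo_at \<alpha> i) + 2))"
    define w where "w = (\<lambda>i. 1 / (sqrt (expo_fact \<alpha>) * (real (expo_at \<alpha> i) + 1)))"
    have R_nonneg: "R i j \<ge> 0" if "i < n" "j < n" for i j
      using \<rho>(1) D2[OF \<alpha> that] by (simp add: R_def)
    have "reverse_CS n (\<lambda>i j. if i = j then \<theta> i * R i i else R i j)"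
    proof (rule reverse_CS_if_four_point[where \<epsilon> = q and D = "real d"])
      show "R i j = R j i" for i j by (simp add: R_def add_ac)
      show "q * (real d * 2 ^ (n + 4)) \<le> 1" using nd by (simp add: q)
      show "R i j * R k l \<le> max (R i k * R j l) (R i l * R j k) + q * min (R i k * R j l) (R i l * R j k)"
        if ijkl: "i < n" "j < n" "k < n" "l < n" for i j k l
      proof -
        have "T_relation q (R j k * R i l) (R i k * R j l) (R i j * R k l)"
          unfolding R_def by (rule weak_T_representation_all_indices[OF J nd(2) W \<alpha> ijkl])
        from T_relation_bound[OF q01 _ _ _ this] show ?thesis
          using R_nonneg ijkl by (simp add: max.commute min.commute mult.commute)
      qed
      show "\<theta> i \<le> 1 - 1 / real d" if "i < n" for i
        using expo_at_le_Delta[OF \<alpha> that] nd by (simp add: \<theta>_def field_simps)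
    qed (use R_nonneg q01 nd in auto)
    from reverse_CS_scale[OF this, of w]
    have "reverse_CS n (\<lambda>i j. w i * w j * (if i = j then \<theta> i * R i i else R i j))" .
    also have "?this \<longleftrightarrow> reverse_CS n (\<lambda>i j. ncoef ?f (\<alpha> + unit_expo i + unit_expo j))"
    proof (rule reverse_CS_cong)
      fix i j assume ij: "i < n" "j < n"
      define x y where "x = real (expo_at \<alpha> i)" and "y = real (expo_at \<alpha> j)"
      have xy: "x \<ge> 0" "y \<ge> 0" by (simp_all add: x_def y_def)
      have "ncoef ?f (\<alpha> + unit_expo i + unit_expo j) = R i j / expo_fact (\<alpha> + unit_expo i + unit_expo j)"
        using D2[OF \<alpha> ij] \<rho>(2)[OF D2[OF \<alpha> ij]] expo_fact_pos[of "\<alpha> + unit_expo i + unit_expo j"]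
        by (auto simp: ncoef_def coef R_def)
      also have "expo_fact (\<alpha> + unit_expo i + unit_expo j) = expo_fact \<alpha> * ((x + 1) * (y + 1 + of_bool (i = j)))"
        unfolding expo_fact_add_unit by (simp add: x_def y_def lookup_add lookup_single)
      also have "R i j / \<dots> = w i * w j * (if i = j then \<theta> i * R i i else R i j)"
      proof -
        have "w i * w j = 1 / ((sqrt (expo_fact \<alpha>) * sqrt (expo_fact \<alpha>)) * ((x + 1) * (y + 1)))"
          by (simp add: w_def x_def y_def mult_ac)
        then have ww: "w i * w j = 1 / (expo_fact \<alpha> * ((x + 1) * (y + 1)))"
          using expo_fact_pos[of \<alpha>] by simp
        have \<theta>: "\<theta> i = (x + 1) / (x + 2)" using xy by (simp add: \<theta>_def x_def[symmetric] field_simps)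
        show ?thesis
        proof (cases "i = j")
          case True
          then have "x = y" by (simp add: x_def y_def)
          with True show ?thesis unfolding ww \<theta> using xy by simp
        next
          case False
          then show ?thesis unfolding ww by simp
        qed
      qed
      finally show "w i * w j * (if i = j then \<theta> i * R i i else R i j) =
          ncoef ?f (\<alpha> + unit_expo i + unit_expo j)" ..
    qed
    finally show "reverse_CS n (\<lambda>i j. ncoef ?f (\<alpha> + unit_expo i + unit_expo j))" .
  qed
  then show ?thesis using supp by (simp add: Lorentzian_with_support_def)
qed

section \<open>From Lorentzian polynomials to weak representations\<close>

text \<open>
  For positive \<open>p, p', r, r'\<close> the bound is optimal when \<open>s u p = t v p'\<close> and \<open>s v r = t u r'\<close>.  The
  general case follows by adding \<open>\<delta> > 0\<close> to each of the four numbers.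
\<close>

lemma sqrt_le_of_quadratic_bound:
  fixes p p' r r' K :: real
  assumes nonneg: "0 \<le> p" "0 \<le> p'" "0 \<le> r" "0 \<le> r'" "0 \<le> K"
    and bound: "\<And>s t u v. 0 < s \<Longrightarrow> 0 < t \<Longrightarrow> 0 < u \<Longrightarrow> 0 < v \<Longrightarrow>
      4 * (s * t * u * v) * K \<le> (s * u * p + s * v * r + t * u * r' + t * v * p')\<^sup>2"
  shows "sqrt K \<le> sqrt (p * p') + sqrt (r * r')"
proof -
  have shifted: "sqrt K \<le> sqrt ((p + \<delta>) * (p' + \<delta>)) + sqrt ((r + \<delta>) * (r' + \<delta>))" if "\<delta> > 0" for \<delta>
  proof -
    define P P' R R' where "P = sqrt (p + \<delta>)" and "P' = sqrt (p' + \<delta>)"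
      and "R = sqrt (r + \<delta>)" and "R' = sqrt (r' + \<delta>)"
    have pos: "P > 0" "P' > 0" "R > 0" "R' > 0"
      using nonneg that by (simp_all add: P_def P'_def R_def R'_def)
    have sq: "p + \<delta> = P\<^sup>2" "p' + \<delta> = P'\<^sup>2" "r + \<delta> = R\<^sup>2" "r' + \<delta> = R'\<^sup>2"
      using nonneg that by (simp_all add: P_def P'_def R_def R'_def)
    define s t u v where "s = P' * R'" and "t = P * R" and "u = P' * R" and "v = P * R'"
    have stuv: "s > 0" "t > 0" "u > 0" "v > 0" using pos by (simp_all add: s_def t_def u_def v_def)
    have "4 * (s * t * u * v) * K \<le> (s * u * p + s * v * r + t * u * r' + t * v * p')\<^sup>2"
      by (rule bound[OF stuv])
    also have "\<dots> \<le> (s * u * P\<^sup>2 + s * v * R\<^sup>2 + t * u * R'\<^sup>2 + t * v * P'\<^sup>2)\<^sup>2"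
      using nonneg stuv that unfolding sq[symmetric]
      by (intro power_mono add_mono mult_left_mono) (auto simp: less_imp_le)
    also have "\<dots> = 4 * (s * t * u * v) * (P * P' + R * R')\<^sup>2"
      by (simp add: s_def t_def u_def v_def power2_eq_square algebra_simps)
    finally have "K \<le> (P * P' + R * R')\<^sup>2" using stuv by simp
    then have "sqrt K \<le> P * P' + R * R'" using pos by (simp add: real_le_lsqrt)
    then show ?thesis unfolding sq using pos by (simp add: real_sqrt_mult)
  qed
  have "((\<lambda>\<delta>. sqrt ((p + \<delta>) * (p' + \<delta>)) + sqrt ((r + \<delta>) * (r' + \<delta>))) \<longlongrightarrow>
      sqrt ((p + 0) * (p' + 0)) + sqrt ((r + 0) * (r' + 0))) (at_right 0)"
    by (intro tendsto_intros)
  then have "sqrt K \<le> sqrt ((p + 0) * (p' + 0)) + sqrt ((r + 0) * (r' + 0))"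
    by (rule tendsto_lowerbound) (use shifted in \<open>auto simp: eventually_at_right_less intro: eventually_mono[OF eventually_at_right_less]\<close>)
  then show ?thesis by simp
qed

text \<open>
  The terms in \<open>H i i\<close>, \<open>H j j\<close>, \<open>H k k\<close> and \<open>H l l\<close> are dropped, except that for \<open>i = j\<close> or \<open>k = l\<close>
  the inequality \<open>(s + t)\<^sup>2 \<ge> 4 s t\<close> takes their place.
\<close>

lemma reverse_CS_four_entries:
  assumes H: "reverse_CS n H" "symmetric_on n H" and nonneg: "\<And>i j. i < n \<Longrightarrow> j < n \<Longrightarrow> H i j \<ge> 0"
    and ijkl: "i < n" "j < n" "k < n" "l < n"
  shows "sqrt ((1 + of_bool (i = j)) * H i j * ((1 + of_bool (k = l)) * H k l))
    \<le> sqrt (H i k * H j l) + sqrt (H i l * H j k)"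
proof (rule sqrt_le_of_quadratic_bound)
  fix s t u v :: real assume pos: "0 < s" "0 < t" "0 < u" "0 < v"
  define e where "e = (\<lambda>i a::nat. if a = i then 1 else 0 :: real)"
  have ee: "bform n H (e a) (e b) = H a b" if "a < n" "b < n" for a b
    using that by (simp add: bform_def e_def if_distrib[of "\<lambda>c. _ * c"] cong: if_cong)
  define pair where "pair = (\<lambda>s t i j a. s * e i a + t * e j a)"
  have form: "bform n H (pair s t i j) (pair u v k l) =
      s * u * H i k + s * v * H i l + t * u * H j k + t * v * H j l"
    if "i < n" "j < n" "k < n" "l < n" for s t u v i j k l
    unfolding pair_def bform_simps using that by (simp add: ee algebra_simps)
  have diag: "bform n H (pair s t i j) (pair s t i j) \<ge> 2 * (s * t) * ((1 + of_bool (i = j)) * H i j)"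
    if "0 < s" "0 < t" "i < n" "j < n" for s t i j
  proof (cases "i = j")
    case True
    have "4 * (s * t) * H i i \<le> (s + t)\<^sup>2 * H i i"
      using nonneg that sum_squares_bound[of s t] by (intro mult_right_mono) (auto simp: power2_sum)
    then show ?thesis using that True by (simp add: form power2_eq_square algebra_simps)
  next
    case False
    have "0 \<le> s * s * H i i" "0 \<le> t * t * H j j" using nonneg that by auto
    moreover have "H j i = H i j" using H(2) that by (simp add: symmetric_on_def)
    ultimately show ?thesis using that False by (simp add: form)
  qed
  let ?a = "2 * (s * t) * ((1 + of_bool (i = j)) * H i j)" and ?b = "2 * (u * v) * ((1 + of_bool (k = l)) * H k l)"
  let ?X = "bform n H (pair s t i j) (pair s t i j)" and ?Y = "bform n H (pair u v k l) (pair u v k l)"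
  have ab: "0 \<le> ?a" "0 \<le> ?b" using pos nonneg ijkl by auto
  have le: "?a \<le> ?X" "?b \<le> ?Y" using diag pos ijkl by blast+
  have XY: "0 \<le> ?X" "0 \<le> ?Y" using ab le by linarith+
  have "?a * ?b \<le> ?X * ?Y" using le ab XY by (intro mult_mono)
  also have "\<dots> \<le> (bform n H (pair s t i j) (pair u v k l))\<^sup>2"
    using H(1) XY unfolding reverse_CS_def by (cases "?X = 0") (auto simp: less_le)
  finally have "?a * ?b \<le> (bform n H (pair s t i j) (pair u v k l))\<^sup>2" .
  moreover have "4 * (s * t * u * v) * (x * y) = (2 * (s * t) * x) * (2 * (u * v) * y)" for x y
    by simp
  ultimately show "4 * (s * t * u * v) * ((1 + of_bool (i = j)) * H i j * ((1 + of_bool (k = l)) * H k l))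
      \<le> (s * u * H i k + s * v * H i l + t * u * H j k + t * v * H j l)\<^sup>2"
    by (simp only: form[OF ijkl])
next
  show "0 \<le> (1 + of_bool (i = j)) * H i j * ((1 + of_bool (k = l)) * H k l)"
    using nonneg[OF ijkl(1,2)] nonneg[OF ijkl(3,4)] by simp
qed (rule nonneg[OF ijkl(1,3)] nonneg[OF ijkl(2,4)] nonneg[OF ijkl(1,4)] nonneg[OF ijkl(2,3)])+

lemma Lorentzian_nonneg_reverse_CS:
  assumes "Lorentzian n d f"
  shows "coef f \<beta> \<ge> 0"
    and "\<alpha> \<in> Delta n (d - 2) \<Longrightarrow> reverse_CS n (\<lambda>i j. ncoef f (\<alpha> + unit_expo i + unit_expo j))"
proof -
  obtain F where F: "\<And>m::nat. strictly_Lorentzian n d (F m)" and lim: "\<And>\<alpha>. (\<lambda>m. coef (F m) \<alpha>) \<longlonglongrightarrow> coef f \<alpha>"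
    using assms unfolding Lorentzian_def by blast
  show "coef f \<beta> \<ge> 0"
    by (rule tendsto_lowerbound[OF lim]) (use F in \<open>auto simp: strictly_Lorentzian_def\<close>)
  assume \<alpha>: "\<alpha> \<in> Delta n (d - 2)"
  show "reverse_CS n (\<lambda>i j. ncoef f (\<alpha> + unit_expo i + unit_expo j))"
  proof (rule reverse_CS_limit)
    show "reverse_CS n (\<lambda>i j. ncoef (F m) (\<alpha> + unit_expo i + unit_expo j))" for m
      by (rule reverse_CS_if_num_pos_eigenvalues)
        (use F[of m] \<alpha> in \<open>auto simp: strictly_Lorentzian_def quadratic_hessian_eq[OF Delta_keys] symmetric_on_def add_ac\<close>)
    show "(\<lambda>m. ncoef (F m) (\<alpha> + unit_expo i + unit_expo j)) \<longlonglongrightarrow> ncoef f (\<alpha> + unit_expo i + unit_expo j)" for i j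
      unfolding ncoef_def by (intro tendsto_intros lim)
  qed
qed

text \<open>
  With \<open>w\<^sub>i = \<alpha>\<^sub>i + 1 \<ge> 1\<close>, the values \<open>R\<^sub>i\<^sub>j = \<rho>(\<alpha> + e\<^sub>i + e\<^sub>j)\<close> and the entries of the Hessian \<open>H\<close>
  satisfy \<open>R\<^sub>i\<^sub>j = \<alpha>! w\<^sub>i w\<^sub>j H\<^sub>i\<^sub>j\<close> for \<open>i \<noteq> j\<close>, and
  \<open>\<alpha>! w\<^sub>i\<^sup>2 H\<^sub>i\<^sub>i \<le> R\<^sub>i\<^sub>i \<le> 2 \<alpha>! w\<^sub>i\<^sup>2 H\<^sub>i\<^sub>i\<close>.
\<close>

lemma Lorentzian_weak_T2_representation:
  assumes J: "M_convex n d J" and f: "f \<in> Lorentzian_with_support n d J"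
  defines "\<rho> \<equiv> \<lambda>\<alpha>. expo_fact \<alpha> * (expo_fact \<alpha> * coef f \<alpha>)"
  shows "weak_T_representation n d J 2 \<rho>" and "Nop (repr_poly J \<rho>) = f"
proof -
  have JD: "J \<subseteq> Delta n d" using J by (simp add: M_convex_def)
  have finJ: "finite J" using JD finite_Delta finite_subset by blast
  have L: "Lorentzian n d f" and supp: "supp f = J" using f by (auto simp: Lorentzian_with_support_def)
  note coef_nonneg = Lorentzian_nonneg_reverse_CS(1)[OF L]
  have \<rho>_nonneg: "\<rho> \<beta> \<ge> 0" for \<beta>
    using coef_nonneg[of \<beta>] expo_fact_pos[of \<beta>] by (simp add: \<rho>_def)
  show "Nop (repr_poly J \<rho>) = f"
  proof (rule poly_mapping_eqI)
    fix \<beta>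
    show "coef (Nop (repr_poly J \<rho>)) \<beta> = coef f \<beta>"
      using supp expo_fact_pos[of \<beta>] by (auto simp: coef_Nop coef_repr_poly[OF finJ] \<rho>_def in_keys_iff)
  qed
  have "{\<beta> \<in> Delta n d. \<rho> \<beta> \<noteq> 0} = J"
  proof -
    have "\<rho> \<beta> \<noteq> 0 \<longleftrightarrow> \<beta> \<in> J" for \<beta>
      using supp expo_fact_pos[of \<beta>] by (auto simp: \<rho>_def in_keys_iff)
    then show ?thesis using JD by auto
  qed
  moreover have "T_relation 2
      (\<rho> (\<alpha> + unit_expo j + unit_expo k) * \<rho> (\<alpha> + unit_expo i + unit_expo l))
      (\<rho> (\<alpha> + unit_expo i + unit_expo k) * \<rho> (\<alpha> + unit_expo j + unit_expo l))
      (\<rho> (\<alpha> + unit_expo i + unit_expo j) * \<rho> (\<alpha> + unit_expo k + unit_expo l))"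
    if \<alpha>: "\<alpha> \<in> Delta n (d - 2)" and ijkl: "i < n" "j < n" "k < n" "l < n" for \<alpha> i j k l
  proof -
    define H where "H = (\<lambda>i j. ncoef f (\<alpha> + unit_expo i + unit_expo j))"
    define R where "R = (\<lambda>i j. \<rho> (\<alpha> + unit_expo i + unit_expo j))"
    define w where "w = (\<lambda>i. real (expo_at \<alpha> i + 1))"
    have w: "w i \<ge> 1" for i by (simp add: w_def)
    have H_nonneg: "H i j \<ge> 0" for i j
      using coef_nonneg expo_fact_pos by (simp add: H_def ncoef_def less_imp_le)
    have R_nonneg: "R i j \<ge> 0" for i j by (simp add: R_def \<rho>_nonneg)
    have R_sym: "R i j = R j i" for i j by (simp add: R_def add_ac)
    have H_CS: "reverse_CS n H" unfolding H_def by (rule Lorentzian_nonneg_reverse_CS(2)[OF L \<alpha>])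
    have H_sym: "symmetric_on n H" by (simp add: H_def symmetric_on_def add_ac)
    define a where "a = expo_fact \<alpha>"
    have a: "a > 0" by (simp add: a_def expo_fact_pos)
    have R: "R i j = a * (w i * w j + of_bool (i = j) * w i) * H i j" for i j
      unfolding R_def H_def \<rho>_def ncoef_def[symmetric] expo_fact_add_unit a_def
      by (simp add: w_def lookup_add lookup_single algebra_simps)
    have R_le: "R i j \<le> a * (w i * w j) * ((1 + of_bool (i = j)) * H i j)" for i j
    proof -
      have "w i * w j + of_bool (i = j) * w i \<le> w i * w j * (1 + of_bool (i = j))"
        using w[of i] by (cases "i = j") auto
      then have "a * (w i * w j + of_bool (i = j) * w i) * H i j \<le> a * (w i * w j * (1 + of_bool (i = j))) * H i j"
        using a H_nonneg by (intro mult_right_mono mult_left_mono) auto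
      then show ?thesis by (simp add: R mult_ac)
    qed
    have R_ge: "a * (w i * w j) * H i j \<le> R i j" for i j
      unfolding R using a H_nonneg w[of i] by (intro mult_right_mono mult_left_mono) auto
    have key: "sqrt (R i j * R k l) \<le> sqrt (R i k * R j l) + sqrt (R i l * R j k)"
      if ijkl: "i < n" "j < n" "k < n" "l < n" for i j k l
    proof -
      define c where "c = a * a * (w i * w j * w k * w l)"
      have wpos: "w i > 0" for i using w[of i] by linarith
      have c: "c \<ge> 0" using a wpos by (simp add: c_def less_imp_le)
      have "R i j * R k l \<le> (a * (w i * w j) * ((1 + of_bool (i = j)) * H i j)) *
          (a * (w k * w l) * ((1 + of_bool (k = l)) * H k l))"
        using a wpos H_nonneg R_nonneg
        by (intro mult_mono R_le mult_nonneg_nonneg) (auto simp: less_imp_le)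
      also have "\<dots> = c * ((1 + of_bool (i = j)) * H i j * ((1 + of_bool (k = l)) * H k l))"
        by (simp add: c_def mult_ac)
      finally have "sqrt (R i j * R k l) \<le> sqrt c * sqrt ((1 + of_bool (i = j)) * H i j * ((1 + of_bool (k = l)) * H k l))"
        by (simp flip: real_sqrt_mult)
      also have "\<dots> \<le> sqrt c * (sqrt (H i k * H j l) + sqrt (H i l * H j k))"
        using c by (intro mult_left_mono reverse_CS_four_entries[OF H_CS H_sym H_nonneg ijkl]) auto
      also have "\<dots> = sqrt (c * (H i k * H j l)) + sqrt (c * (H i l * H j k))"
        by (simp add: real_sqrt_mult distrib_left)
      also have "\<dots> \<le> sqrt (R i k * R j l) + sqrt (R i l * R j k)"
      proof (intro add_mono real_sqrt_le_mono)
        have "c * (H x k' * H y l') \<le> R x k' * R y l'"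
          if "w x * w y * w k' * w l' = w i * w j * w k * w l" for x y k' l'
        proof -
          have "c * (H x k' * H y l') = (a * (w x * w k') * H x k') * (a * (w y * w l') * H y l')"
            unfolding c_def that[symmetric] by (simp add: mult_ac)
          also have "\<dots> \<le> R x k' * R y l'"
            using a wpos H_nonneg R_nonneg
            by (intro mult_mono R_ge mult_nonneg_nonneg) (auto simp: less_imp_le)
          finally show ?thesis .
        qed
        then show "c * (H i k * H j l) \<le> R i k * R j l" "c * (H i l * H j k) \<le> R i l * R j k"
          by (simp_all add: mult_ac)
      qed
      finally show ?thesis .
    qed
    have "T_relation 2 (R j k * R i l) (R i k * R j l) (R i j * R k l)"
      unfolding T_relation_def
      using key[OF ijkl] key[OF ijkl(1,3,2,4)] key[OF ijkl(2,3,1,4)] R_nonneg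
      by (simp add: powr_half_sqrt R_sym mult.commute add.commute)
    then show ?thesis by (simp add: R_def)
  qed
  ultimately show "weak_T_representation n d J 2 \<rho>"
    unfolding weak_T_representation_def using \<rho>_nonneg by auto
qed

section \<open>The two inclusions\<close>

theorem theorem1p1:
  fixes n d :: nat and J :: "expo set"
  assumes "n \<ge> 1" and "d \<ge> 2" and "M_convex n d J"
  shows "\<exists>q::real. q > 0 \<and>
           Nop_class ` Gr_weak n d J q \<subseteq> PL n d J \<and>
           PL n d J \<subseteq> Nop_class ` Gr_weak n d J 2"
proof -
  define q where "q = 1 / (real d * 2 ^ (n + 4))"
  have "q > 0" using assms(2) by (simp add: q_def)
  moreover have "Nop_class ` Gr_weak n d J q \<subseteq> PL n d J"
  proof
    fix C assume "C \<in> Nop_class ` Gr_weak n d J q"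
    then obtain \<rho> where "weak_T_representation n d J q \<rho>" "C = Nop_class (pos_scaling `` {repr_poly J \<rho>})"
      by (auto simp: Gr_weak_def quotient_def)
    then show "C \<in> PL n d J"
      using Nop_repr_poly_Lorentzian[OF assms q_def] by (auto simp: Nop_image_class PL_def intro: quotientI)
  qed
  moreover have "PL n d J \<subseteq> Nop_class ` Gr_weak n d J 2"
  proof
    fix C assume "C \<in> PL n d J"
    then obtain f where f: "f \<in> Lorentzian_with_support n d J" "C = pos_scaling `` {f}"
      by (auto simp: PL_def quotient_def)
    from Lorentzian_weak_T2_representation[OF assms(3) f(1)] obtain \<rho>
      where "weak_T_representation n d J 2 \<rho>" "Nop (repr_poly J \<rho>) = f" by blast
    then have "C = Nop_class (pos_scaling `` {repr_poly J \<rho>})" "pos_scaling `` {repr_poly J \<rho>} \<in> Gr_weak n d J 2"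
      by (auto simp: Nop_image_class f(2) Gr_weak_def intro: quotientI)
    then show "C \<in> Nop_class ` Gr_weak n d J 2" by blast
  qed
  ultimately show ?thesis by blast
qed

end
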